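(* Let $X\subseteq U\times V$ be (the edge set of) a specified bipartite graph on $U\cup V$. Suppose that, as $S\to\infty$, $s_{\max}+t_{\max}=o(S/\log S)$, $\delta_{\max}=o(S)$, $\delta_{\max}F=o(S^2)$ and $F=o(S^{5/3})$. Then $$B(\boldsymbol{s},\boldsymbol{t},X)=B(\boldsymbol{s},\boldsymbol{t})\,\exp\left(-\frac{F}{S}-\frac{3F^2}{2S^3}+O\left(\frac{\delta_{\max}F}{S^2}+\frac{F^3}{S^5}\right)\right).$$
   Context: Let $U=\{u_1,\ldots,u_m\}$ and $V=\{v_1,\ldots,v_n\}$ be disjoint vertex sets. Let $\boldsymbol{s}=(s_1,\ldots,s_m)$ and $\boldsymbol{t}=(t_1,\ldots,t_n)$ be vectors of nonnegative integers with $S=\sum_{i=1}^m s_i=\sum_{j=1}^n t_j$, and let $s_{\max}=\max_i s_i$, $t_{\max}=\max_j t_j$. $\mathcal{B}(\boldsymbol{s},\boldsymbol{t})$ is the set of simple bipartite graphs with vertex bipartition $U\cup V$ in which $u_i$ has degree $s_i$ for all $i$ and $v_j$ has degree $t_j$ for all $j$; $B(\boldsymbol{s},\boldsymbol{t})=|\mathcal{B}(\boldsymbol{s},\boldsymbol{t})|$. Graphs are identified with their edge sets, and the edge $\{u_i,v_j\}$ is written $u_iv_j$. For $X\subseteq U\times V$, $B(\boldsymbol{s},\boldsymbol{t},X)$ is the number of graphs in $\mathcal{B}(\boldsymbol{s},\boldsymbol{t})$ which contain no edge of $X$. Let $(\boldsymbol{x},\boldsymbol{y})$ be the degree sequence of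 $X$: $u_i$ is in exactly $x_i$ edges of $X$ and $v_j$ is in exactly $y_j$ edges of $X$. Let $x_{\max}=\max_i x_i$, $y_{\max}=\max_j y_j$, and $$F=F(X)=\sum_{u_iv_j\in X}s_it_j,\qquad \delta_{\max}=s_{\max}t_{\max}+s_{\max}y_{\max}+x_{\max}t_{\max}.$$ Asymptotic convention: one considers an infinite family of instances $(m,n,\boldsymbol{s},\boldsymbol{t},X)$ along which $S\to\infty$; the $o(\cdot)$ hypotheses refer to this limit, and $O(g)$ denotes a quantity (of either sign) whose absolute value is at most a constant times $g$ for all sufficiently large $S$, the constant being uniform over the family. $\log$ is the natural logarithm. *)

theory Defs
  imports Complex_Main "HOL-Library.Landau_Symbols"
begin

text \<open>
  The vertices \<open>u\<^sub>1, \<dots>, u\<^sub>m\<close> and \<open>v\<^sub>1, \<dots>, v\<^sub>n\<close> are represented by their indices, and the edge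
  \<open>u\<^sub>i v\<^sub>j\<close> by the ordered pair \<open>(i, j)\<close>; the two sides are told apart by the position in the pair.
  A vector is a function of which only the values at \<open>1, \<dots>, m\<close> (or \<open>1, \<dots>, n\<close>) are used.
\<close>

type_synonym bigraph = "(nat \<times> nat) set"

definition degU :: "bigraph \<Rightarrow> nat \<Rightarrow> nat" where
  "degU G i = card {j. (i, j) \<in> G}"

definition degV :: "bigraph \<Rightarrow> nat \<Rightarrow> nat" where
  "degV G j = card {i. (i, j) \<in> G}"

definition bigraphs :: "nat \<Rightarrow> nat \<Rightarrow> (nat \<Rightarrow> nat) \<Rightarrow> (nat \<Rightarrow> nat) \<Rightarrow> bigraph set" where
  "bigraphs m n s t =
     {G. G \<subseteq> {1..m} \<times> {1..n} \<and> (\<forall>i\<in>{1..m}. degU G i = s i) \<and> (\<forall>j\<in>{1..n}. degV G j = t j)}"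

definition num_bigraphs :: "nat \<Rightarrow> nat \<Rightarrow> (nat \<Rightarrow> nat) \<Rightarrow> (nat \<Rightarrow> nat) \<Rightarrow> nat" where
  "num_bigraphs m n s t = card (bigraphs m n s t)"

definition num_bigraphs_avoiding ::
    "nat \<Rightarrow> nat \<Rightarrow> (nat \<Rightarrow> nat) \<Rightarrow> (nat \<Rightarrow> nat) \<Rightarrow> bigraph \<Rightarrow> nat" where
  "num_bigraphs_avoiding m n s t X = card {G \<in> bigraphs m n s t. G \<inter> X = {}}"

text \<open>
  For \<open>n = 0\<close> the maximum is unspecified. This value plays no role in limits along which the sum
  of the entries tends to infinity.
\<close>

definition vec_max :: "nat \<Rightarrow> (nat \<Rightarrow> nat) \<Rightarrow> nat" where
  "vec_max n a = Max (a ` {1..n})"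

definition forbidden_weight :: "(nat \<Rightarrow> nat) \<Rightarrow> (nat \<Rightarrow> nat) \<Rightarrow> bigraph \<Rightarrow> nat" where
  "forbidden_weight s t X = (\<Sum>(i, j)\<in>X. s i * t j)"

definition delta_max ::
    "nat \<Rightarrow> nat \<Rightarrow> (nat \<Rightarrow> nat) \<Rightarrow> (nat \<Rightarrow> nat) \<Rightarrow> bigraph \<Rightarrow> nat" where
  "delta_max m n s t X =
     vec_max m s * vec_max n t + vec_max m s * vec_max n (degV X) + vec_max m (degU X) * vec_max n t"

end

theory Submission imports Defs begin

text \<open>
  Let \<open>N\<^sub>k\<close> be the number of graphs with exactly \<open>k\<close> edges in \<open>X\<close>, so that the theorem is about
  \<open>N\<^sub>0 / \<Sum>\<^sub>k N\<^sub>k\<close>. The switching \<open>u\<^sub>i v\<^sub>j, u\<^sub>a v\<^sub>b, u\<^sub>c v\<^sub>d \<mapsto> u\<^sub>i v\<^sub>b, u\<^sub>c v\<^sub>j, u\<^sub>a v\<^sub>d\<close>, where \<open>u\<^sub>i v\<^sub>j\<close> is the only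
  edge in \<open>X\<close> among the six, gives, for \<open>k \<le> S / 4\<close>,
  \<open>(k + 1) N\<^bsub>k+1\<^esub> / N\<^sub>k = (F / S) (1 + k / S + F / S\<^sup>2 + small)\<close>. The contribution \<open>F / S\<^sup>2\<close> comes from
  the pairs of edges \<open>u\<^sub>a v\<^sub>b\<close>, \<open>u\<^sub>c v\<^sub>d\<close> for which \<open>u\<^sub>a v\<^sub>d\<close> lies in \<open>X\<close>. For the truncated generating
  function \<open>Z(x) = \<Sum> N\<^sub>k x\<^sup>k\<close> over \<open>k \<le> S / 4\<close> this recursion says that
  \<open>(ln Z)' = F / S + F\<^sup>2 / S\<^sup>3 + x F\<^sup>2 / S\<^sup>3\<close> up to the allowed error, and integration over \<open>[0, 1]\<close>
  produces \<open>F / S + 3 F\<^sup>2 / (2 S\<^sup>3)\<close>. The graphs with more than \<open>S / 4\<close> edges in \<open>X\<close> are negligible by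
  Markov's inequality, as a two-edge switching bounds the mean number of edges in \<open>X\<close> by \<open>2 F / S\<close>.
\<close>

subsection \<open>Sequences with nearly Poisson ratios\<close>

text \<open>
  The correction \<open>real j * d\<close> in \<open>low\<close> carries no factor \<open>lam\<close>; it is harmless because the mean of \<open>j\<close>
  under the weights \<open>M j * x ^ j\<close> is of order \<open>lam\<close>.
\<close>

lemma exp_family_log_sum:
  fixes M :: "nat \<Rightarrow> real" and lam l d S C :: real and K :: nat
  assumes M_nonneg: "\<And>j. M j \<ge> 0" and M0: "M 0 > 0" and M_big: "\<And>j. j > K \<Longrightarrow> M j = 0"
    and KS: "real K \<le> S" and S: "S \<ge> 1" and lam: "lam \<ge> 0" and l: "l = lam / S" "l \<le> 1"
    and d: "1 / S \<le> d" "d \<le> 1" and C: "C \<ge> 0"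
    and up: "\<And>j. real (Suc j) * M (Suc j) \<le> M j * (lam * (1 + real j / S + l + C * (d + (real j / S)\<^sup>2 + l\<^sup>2)))"
    and low: "\<And>j. real (Suc j) * M (Suc j) \<ge> M j * (lam * (1 + real j / S + l - C * (d + (real j / S)\<^sup>2 + l\<^sup>2)) - C * real j * d)"
  defines "A \<equiv> 3 + 3 * C"
  shows "\<bar>ln (\<Sum>j\<le>K. M j) - ln (M 0) - lam - 3 / 2 * lam * l\<bar> \<le> (2 * (C * (A\<^sup>2 + 2 * A + 2)) + 1 + A) * (lam * d + lam * l\<^sup>2)"
proof -
  \<comment> \<open>\<open>Z\<close> is the generating polynomial, \<open>D\<close> turns out to be
    its derivative, and \<open>m1\<close>, \<open>m2\<close> are the unnormalised first and second
    moments under the weights \<open>M j * x ^ j\<close>.\<close>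
  define Z D m1 m2 where "Z x = (\<Sum>j\<le>K. M j * x ^ j)"
    and "D x = (\<Sum>j\<le>K. real (Suc j) * M (Suc j) * x ^ j)"
    and "m1 x = (\<Sum>j\<le>K. real j * (M j * x ^ j))"
    and "m2 x = (\<Sum>j\<le>K. (real j)\<^sup>2 * (M j * x ^ j))" for x
  have l0: "l \<ge> 0" and d0: "d \<ge> 0" and A: "A \<ge> 3"
    using l lam S d C by (auto simp: A_def intro: order_trans[rotated])
  define \<epsilon> where "\<epsilon> = lam * d + lam * l\<^sup>2"
  have \<epsilon>0: "\<epsilon> \<ge> 0" by (simp add: \<epsilon>_def lam d0)
  \<comment> \<open>For \<open>j \<le> K\<close> the numbers \<open>j / S\<close>, \<open>l\<close>
    and \<open>d\<close> are at most 1, so the bracket in \<open>up\<close> is at most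
    \<open>3 + 3 * C\<close>; this is where \<open>A\<close> comes from.\<close>
  have crude: "real (Suc j) * M (Suc j) \<le> A * lam * M j" for j
  proof (cases "j \<le> K")
    case True
    define q where "q = real j / S"
    have q: "0 \<le> q" "q \<le> 1" using True KS S by (auto simp: q_def divide_simps)
    have "q\<^sup>2 \<le> 1" "l\<^sup>2 \<le> 1" using q l0 l by (auto simp: power_le_one)
    then have "C * (d + q\<^sup>2 + l\<^sup>2) \<le> C * 3"
      by (intro mult_left_mono) (use d C in auto)
    then have "1 + q + l + C * (d + q\<^sup>2 + l\<^sup>2) \<le> A" using q l unfolding A_def by linarith
    then have "M j * (lam * (1 + q + l + C * (d + q\<^sup>2 + l\<^sup>2))) \<le> M j * (lam * A)"
      by (intro mult_left_mono) (use lam M_nonneg in auto)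
    then show ?thesis using up[of j] unfolding q_def by (simp add: mult_ac)
  next
    case False
    then show ?thesis using M_big[of j] M_big[of "Suc j"] by simp
  qed
  \<comment> \<open>The right-hand sum may stop at \<open>K\<close> again because
    \<open>M (Suc K) = 0\<close>. With a factor \<open>j\<close> in \<open>f\<close>, the identity
    prepares a moment for the ratio bounds.\<close>
  have shift: "(\<Sum>j\<le>K. f j * M j) = f 0 * M 0 + (\<Sum>j\<le>K. f (Suc j) * M (Suc j))" for f :: "nat \<Rightarrow> real"
  proof -
    have "(\<Sum>j\<le>K. f j * M j) = (\<Sum>j\<le>Suc K. f j * M j)" using M_big[of "Suc K"] by simp
    also have "\<dots> = f 0 * M 0 + (\<Sum>j\<le>K. f (Suc j) * M (Suc j))" by (rule sum.atMost_Suc_shift)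
    finally show ?thesis .
  qed
  have m1D: "m1 x = x * D x" for x
    using shift[of "\<lambda>j. real j * x ^ j"] by (simp add: m1_def D_def sum_distrib_left mult_ac)
  have deriv: "(Z has_real_derivative D x) (at x)" for x
  proof -
    have "(Z has_real_derivative (\<Sum>j\<le>K. M j * (real j * x ^ (j - 1)))) (at x)"
      unfolding Z_def by (auto intro!: derivative_eq_intros sum.cong)
    moreover have "(\<Sum>j\<le>K. M j * (real j * x ^ (j - 1))) = (\<Sum>j\<le>K. real j * x ^ (j - 1) * M j)"
      by (simp only: mult_ac)
    moreover have "\<dots> = D x"
      unfolding shift by (simp add: D_def mult_ac)
    ultimately show ?thesis by simp
  qed
  \<comment> \<open>This controls the logarithmic derivative of \<open>Z\<close>: the ratio bounds
    express \<open>D\<close> through \<open>Z\<close>, \<open>m1\<close> and \<open>m2\<close>, and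
    in the term \<open>l * m1\<close> the moment \<open>m1\<close> is then replaced by
    \<open>x * lam * Z\<close>.\<close>
  have est: "Z x > 0 \<and> \<bar>D x / Z x - lam * (1 + l) - x * lam * l\<bar> \<le> (2 * (C * (A\<^sup>2 + 2 * A + 2)) + 1 + A) * \<epsilon>"
    if x: "0 \<le> x" "x \<le> 1" for x
  proof -
    define e where "e j = M j * x ^ j" for j
    have e0: "e j \<ge> 0" for j by (simp add: e_def M_nonneg x)
    have "Z x = M 0 + (\<Sum>j\<le>K. M (Suc j) * x ^ Suc j)"
      using shift[of "\<lambda>j. x ^ j"] by (simp add: Z_def mult_ac)
    moreover have "(\<Sum>j\<le>K. M (Suc j) * x ^ Suc j) \<ge> 0" by (intro sum_nonneg) (use M_nonneg x in auto)
    ultimately have Z: "Z x > 0" using M0 by linarith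
    have D0: "D x \<ge> 0" unfolding D_def by (intro sum_nonneg) (use M_nonneg x in auto)
    have m10: "m1 x \<ge> 0" using D0 m1D x by simp
    have "D x \<le> (\<Sum>j\<le>K. A * lam * M j * x ^ j)"
      unfolding D_def by (intro sum_mono mult_right_mono crude) (use x in auto)
    then have Dc: "D x \<le> A * lam * Z x" by (simp add: Z_def sum_distrib_left mult_ac)
    have "m1 x \<le> D x" unfolding m1D using x D0 by (simp add: mult_left_le_one_le)
    then have m1c: "m1 x \<le> A * lam * Z x" using Dc by linarith
    \<comment> \<open>The difference is the second factorial moment, to which \<open>crude\<close>
      applies once more after an index shift.\<close>
    have "m2 x - m1 x = (\<Sum>j\<le>K. real j * (real j - 1) * x ^ j * M j)"
      unfolding m2_def m1_def by (simp add: sum_subtractf[symmetric] power2_eq_square algebra_simps)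
    also have "\<dots> = x * (\<Sum>j\<le>K. real j * x ^ j * (real (Suc j) * M (Suc j)))"
      using shift[of "\<lambda>j. real j * (real j - 1) * x ^ j"] by (simp add: sum_distrib_left mult_ac)
    also have "\<dots> \<le> x * (\<Sum>j\<le>K. real j * x ^ j * (A * lam * M j))"
      by (intro mult_left_mono sum_mono crude) (use x in auto)
    also have "\<dots> = x * (A * lam * m1 x)" by (simp add: m1_def sum_distrib_left mult_ac)
    also have "\<dots> \<le> A * lam * m1 x" by (intro mult_left_le_one_le) (use x m10 A lam in auto)
    also have "\<dots> \<le> A * lam * (A * lam * Z x)" by (intro mult_left_mono m1c) (use A lam in auto)
    finally have m2c: "m2 x \<le> (A\<^sup>2 * lam\<^sup>2 + A * lam) * Z x"
      using m1c by (simp add: power2_eq_square algebra_simps)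
    have "D x \<le> (\<Sum>j\<le>K. (lam * (1 + l + C * d + C * l\<^sup>2)) * e j + lam / S * (real j * e j) + C * lam / S\<^sup>2 * ((real j)\<^sup>2 * e j))"
      unfolding D_def
    proof (rule sum_mono)
      fix j
      have "real (Suc j) * M (Suc j) * x ^ j \<le> M j * (lam * (1 + real j / S + l + C * (d + (real j / S)\<^sup>2 + l\<^sup>2))) * x ^ j"
        by (intro mult_right_mono up) (use x in auto)
      then show "real (Suc j) * M (Suc j) * x ^ j \<le> (lam * (1 + l + C * d + C * l\<^sup>2)) * e j + lam / S * (real j * e j) + C * lam / S\<^sup>2 * ((real j)\<^sup>2 * e j)"
        by (simp add: e_def algebra_simps power_divide)
    qed
    then have Dup: "D x \<le> lam * (1 + l + C * d + C * l\<^sup>2) * Z x + lam / S * m1 x + C * lam / S\<^sup>2 * m2 x"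
      by (simp add: sum.distrib sum_distrib_left Z_def m1_def m2_def e_def)
    have "D x \<ge> (\<Sum>j\<le>K. (lam * (1 + l - C * d - C * l\<^sup>2)) * e j + lam / S * (real j * e j) - C * lam / S\<^sup>2 * ((real j)\<^sup>2 * e j) - C * d * (real j * e j))"
      unfolding D_def
    proof (rule sum_mono)
      fix j
      have "real (Suc j) * M (Suc j) * x ^ j \<ge> M j * (lam * (1 + real j / S + l - C * (d + (real j / S)\<^sup>2 + l\<^sup>2)) - C * real j * d) * x ^ j"
        by (intro mult_right_mono low) (use x in auto)
      then show "real (Suc j) * M (Suc j) * x ^ j \<ge> (lam * (1 + l - C * d - C * l\<^sup>2)) * e j + lam / S * (real j * e j) - C * lam / S\<^sup>2 * ((real j)\<^sup>2 * e j) - C * d * (real j * e j)"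
        by (simp add: e_def algebra_simps power_divide)
    qed
    then have Dlow: "D x \<ge> lam * (1 + l - C * d - C * l\<^sup>2) * Z x + lam / S * m1 x - C * lam / S\<^sup>2 * m2 x - C * d * m1 x"
      by (simp add: sum.distrib sum_subtractf sum_distrib_left Z_def m1_def m2_def e_def)
    have "lam / S\<^sup>2 * m2 x \<le> lam / S\<^sup>2 * ((A\<^sup>2 * lam\<^sup>2 + A * lam) * Z x)"
      by (intro mult_left_mono m2c) (use lam in auto)
    also have "\<dots> = (A\<^sup>2 * (lam * l\<^sup>2) + A * (lam * (l * (1 / S)))) * Z x"
    proof -
      have "lam = l * S" using l(1) S by simp
      then show ?thesis using S by (simp add: power2_eq_square field_simps)
    qed
    also have "\<dots> \<le> (A\<^sup>2 * \<epsilon> + A * \<epsilon>) * Z x"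
    proof (intro mult_right_mono add_mono mult_left_mono)
      have "l * (1 / S) \<le> 1 * d" by (intro mult_mono) (use l d S in auto)
      then have "lam * (l * (1 / S)) \<le> lam * d" using lam by (intro mult_left_mono) auto
      then show "lam * (l * (1 / S)) \<le> \<epsilon>" unfolding \<epsilon>_def using lam by (smt (verit) mult_nonneg_nonneg zero_le_power2)
    qed (use Z A lam d0 in \<open>auto simp: \<epsilon>_def\<close>)
    finally have m2e: "C * lam / S\<^sup>2 * m2 x \<le> C * ((A\<^sup>2 * \<epsilon> + A * \<epsilon>) * Z x)"
      using C by (metis (no_types, lifting) mult.assoc mult_left_mono times_divide_eq_right)
    have "d * m1 x \<le> d * (A * lam * Z x)" by (intro mult_left_mono m1c d0)
    also have "\<dots> = A * (lam * d) * Z x" by simp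
    also have "\<dots> \<le> A * \<epsilon> * Z x"
      by (intro mult_right_mono mult_left_mono) (use A Z lam in \<open>auto simp: \<epsilon>_def\<close>)
    finally have m1e: "C * d * m1 x \<le> C * (A * \<epsilon> * Z x)"
      using C by (metis mult.assoc mult_left_mono)
    have eqe: "lam * (1 + l + C * d + C * l\<^sup>2) * Z x = lam * (1 + l) * Z x + C * \<epsilon> * Z x"
      "lam * (1 + l - C * d - C * l\<^sup>2) * Z x = lam * (1 + l) * Z x - C * \<epsilon> * Z x"
      by (simp_all add: \<epsilon>_def algebra_simps)
    define C3 where "C3 = C * (A\<^sup>2 + 2 * A + 2)"
    have C30: "C3 \<ge> 0" using C A by (auto simp: C3_def)
    have C3e: "C3 * \<epsilon> * Z x = C * ((A\<^sup>2 * \<epsilon> + A * \<epsilon>) * Z x) + C * (A * \<epsilon> * Z x) + 2 * (C * \<epsilon> * Z x)"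
      by (simp add: C3_def algebra_simps)
    have nn: "C * (A * \<epsilon> * Z x) \<ge> 0" "C * \<epsilon> * Z x \<ge> 0" using C A \<epsilon>0 Z by auto
    have main: "\<bar>D x - lam * (1 + l) * Z x - l * m1 x\<bar> \<le> C3 * \<epsilon> * Z x"
      using Dup Dlow eqe m1e m2e C3e nn l(1) by (auto simp: abs_le_iff)
    have lm1: "0 \<le> l * m1 x" "l * m1 x \<le> l * (A * lam * Z x)"
      using l0 m10 m1c by (auto intro: mult_left_mono)
    \<comment> \<open>Bootstrap: the crude moment bound gives \<open>D\<close> to first order, hence
      also \<open>m1 = x * D\<close>. The extra factor \<open>l\<close> turns the error
      \<open>lam * l\<close> into \<open>lam * l\<^sup>2\<close>, which is part of
      \<epsilon>.\<close>
    have "\<bar>D x - lam * Z x\<bar> \<le> ((1 + A) * lam * l + C3 * \<epsilon>) * Z x"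
    proof -
      have "0 \<le> l * (lam * Z x)" "0 \<le> A * (l * (lam * Z x))" using l0 lam Z A by simp_all
      then show ?thesis using main lm1 unfolding abs_le_iff
        by (simp add: algebra_simps)
    qed
    then have xD: "x * \<bar>D x - lam * Z x\<bar> \<le> 1 * (((1 + A) * lam * l + C3 * \<epsilon>) * Z x)"
      by (intro mult_mono) (use x in auto)
    have "\<bar>m1 x - x * lam * Z x\<bar> \<le> ((1 + A) * lam * l + C3 * \<epsilon>) * Z x"
    proof -
      have "m1 x - x * lam * Z x = x * (D x - lam * Z x)" by (simp add: m1D algebra_simps)
      then have "\<bar>m1 x - x * lam * Z x\<bar> = x * \<bar>D x - lam * Z x\<bar>" using x by (simp add: abs_mult)
      with xD show ?thesis by linarith
    qed
    then have "l * \<bar>m1 x - x * lam * Z x\<bar> \<le> l * (((1 + A) * lam * l + C3 * \<epsilon>) * Z x)"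
      using l0 by (intro mult_left_mono)
    also have "\<dots> = ((1 + A) * (lam * l\<^sup>2) + l * (C3 * \<epsilon>)) * Z x"
      by (simp add: power2_eq_square algebra_simps)
    also have "\<dots> \<le> ((1 + A) * \<epsilon> + 1 * (C3 * \<epsilon>)) * Z x"
      by (intro mult_right_mono add_mono mult_left_mono)
        (use l A C30 \<epsilon>0 Z lam d0 in \<open>auto simp: \<epsilon>_def\<close>)
    also have "l * \<bar>m1 x - x * lam * Z x\<bar> = \<bar>l * (m1 x - x * lam * Z x)\<bar>"
      using l0 by (simp add: abs_mult)
    finally have "\<bar>l * m1 x - x * lam * l * Z x\<bar> \<le> ((1 + A) * \<epsilon> + C3 * \<epsilon>) * Z x"
      by (simp add: algebra_simps)
    with main have "\<bar>D x - (lam * (1 + l) + x * lam * l) * Z x\<bar> \<le> (2 * C3 + 1 + A) * \<epsilon> * Z x"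
      by (simp add: abs_le_iff algebra_simps)
    moreover have "D x / Z x - lam * (1 + l) - x * lam * l = (D x - (lam * (1 + l) + x * lam * l) * Z x) / Z x"
      using Z by (simp add: field_simps)
    ultimately have "\<bar>D x / Z x - lam * (1 + l) - x * lam * l\<bar> \<le> (2 * C3 + 1 + A) * \<epsilon>"
      using Z by (simp add: divide_simps)
    then show ?thesis using Z by (simp add: C3_def)
  qed
  define c where "c = (2 * (C * (A\<^sup>2 + 2 * A + 2)) + 1 + A) * \<epsilon>"
  \<comment> \<open>Subtracting the antiderivative of the main term leaves a function whose
    derivative on [0, 1] is at most \<open>c\<close> in absolute value. At 1 the subtracted term is
    \<open>lam * (1 + l) + lam * l / 2 = lam + 3 / 2 * lam * l\<close>.\<close>
  define g where "g x = ln (Z x) - (lam * (1 + l) * x + lam * l * x\<^sup>2 / 2)" for x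
  have dg: "(g has_real_derivative (D x / Z x - lam * (1 + l) - x * lam * l)) (at x)"
    if "0 \<le> x" "x \<le> 1" for x
    unfolding g_def using est[OF that] by (auto intro!: derivative_eq_intros deriv)
  obtain z where z: "0 < z" "z < 1"
    and gz: "g 1 - g 0 = (1 - 0) * (D z / Z z - lam * (1 + l) - z * lam * l)"
    using MVT2[of 0 1 g "\<lambda>x. D x / Z x - lam * (1 + l) - x * lam * l"] dg by auto
  have "\<bar>g 1 - g 0\<bar> \<le> c" using gz est[of z] z by (simp add: c_def)
  moreover have "Z 0 = M 0" unfolding Z_def using shift[of "\<lambda>j. 0 ^ j"] by (simp add: mult_ac)
  moreover have "Z 1 = (\<Sum>j\<le>K. M j)" by (simp add: Z_def)
  ultimately show ?thesis unfolding g_def c_def \<epsilon>_def by (simp add: algebra_simps)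
qed

text \<open>Here \<open>a\<close>, \<open>l\<close>, \<open>d\<close> stand for
  \<open>j / S\<close>, \<open>F / S\<^sup>2\<close>, \<open>\<Delta> / S\<close>. The quotient of
  \<open>1 - a\<close> by \<open>(1 - a)\<^sup>2 - l\<close> is \<open>1 + a + l\<close> up to
  second order. Since the first factor \<open>P\<close> is at least 1/2, the constant 40 supplies 20
  times each of \<open>d\<close>, \<open>a\<^sup>2\<close>, \<open>l\<^sup>2\<close>, which exceeds
  the losses of \<open>15 * d\<close> and 5/2 times the squares.\<close>

lemma switching_quotient_le:
  fixes a l d :: real
  assumes "0 \<le> a" "a \<le> 1/4" "0 \<le> l" "l \<le> 1/100" "0 \<le> d" "d \<le> 1/500"
  shows "1 - a \<le> ((1 - a)\<^sup>2 - l - 5 * d) * (1 + a + l + 40 * (d + a\<^sup>2 + l\<^sup>2))"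
proof -
  define P R where "P = (1 - a)\<^sup>2 - l - 5 * d" and "R = d + a\<^sup>2 + l\<^sup>2"
  have "(1 - a)\<^sup>2 \<ge> (3/4)\<^sup>2" using assms by (intro power_mono) auto
  then have Pn: "P \<ge> 1/2" using assms by (simp add: P_def power2_eq_square)
  define u v where "u = P * (1 + a + l)" and "v = P * (40 * R)"
  define al da dl a3 aal where "al = a * l" and "da = d * a" and "dl = d * l" and "a3 = a ^ 3" and "aal = a\<^sup>2 * l"
  have al: "al \<le> (a\<^sup>2 + l\<^sup>2) / 2" using sum_squares_bound[of a l] by (simp add: al_def)
  have dd: "da \<le> d" "dl \<le> d" using assms by (auto simp: da_def dl_def intro: mult_left_le)
  have nn: "a3 \<ge> 0" "aal \<ge> 0" using assms by (auto simp: a3_def aal_def)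
  have v: "20 * d + 20 * a\<^sup>2 + 20 * l\<^sup>2 \<le> v"
    using mult_right_mono[OF Pn, of "40 * R"] assms by (simp add: v_def R_def)
  have u: "u = 1 - a - a\<^sup>2 + a3 - 3 * al + aal - l\<^sup>2 - 5 * d - 5 * da - 5 * dl"
    by (simp add: u_def P_def a3_def aal_def al_def da_def dl_def power2_eq_square power3_eq_cube algebra_simps)
  have "u \<ge> 1 - a - 5 / 2 * a\<^sup>2 - 5 / 2 * l\<^sup>2 - 15 * d"
    using al dd nn unfolding u by (simp add: field_simps)
  then have "1 - a \<le> u + v"
    using v zero_le_power2[of a] zero_le_power2[of l] assms(5) by linarith
  then show ?thesis by (simp only: u_def v_def P_def R_def distrib_left)
qed

text \<open>The companion for the opposite pair of counts: \<open>d\<close> on the left accounts for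
  edges of the graph that lie in \<open>X\<close>, and \<open>2 * d\<close> on the right for blocked
  backward moves. Again \<open>P \<ge> 1/2\<close> leaves 20 times the error terms as slack.\<close>

lemma switching_quotient_ge:
  fixes a l d :: real
  assumes "0 \<le> a" "a \<le> 1/4" "0 \<le> l" "l \<le> 1/100" "0 \<le> d" "d \<le> 1/500"
  shows "((1 - a)\<^sup>2 - l + d) * (1 + a + l - 40 * (d + a\<^sup>2 + l\<^sup>2)) \<le> 1 - a - 2 * d"
proof -
  define P R where "P = (1 - a)\<^sup>2 - l + d" and "R = d + a\<^sup>2 + l\<^sup>2"
  have "(1 - a)\<^sup>2 \<ge> (3/4)\<^sup>2" using assms by (intro power_mono) auto
  then have Pn: "P \<ge> 1/2" using assms by (simp add: P_def power2_eq_square)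
  define u v where "u = P * (1 + a + l)" and "v = P * (40 * R)"
  define al da dl where "al = a * l" and "da = d * a" and "dl = d * l"
  have "al \<ge> 0" using assms by (simp add: al_def)
  moreover have "da \<le> d" "dl \<le> d" using assms by (auto simp: da_def dl_def intro: mult_left_le)
  moreover have "a ^ 3 \<le> a\<^sup>2" "a\<^sup>2 * l \<le> a\<^sup>2"
    using assms by (auto simp: power3_eq_cube power2_eq_square intro: mult_left_le)
  moreover have "(1/2) * (40 * R) \<le> v"
    unfolding v_def using assms by (intro mult_right_mono Pn) (auto simp: R_def)
  moreover have "u = 1 - a - a\<^sup>2 + a ^ 3 - 3 * al + a\<^sup>2 * l - l\<^sup>2 + d + da + dl"
    by (simp add: u_def P_def al_def da_def dl_def power2_eq_square power3_eq_cube algebra_simps)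
  moreover have "a\<^sup>2 \<ge> 0" "l\<^sup>2 \<ge> 0" by auto
  ultimately have "u - v \<le> 1 - a - 2 * d" using assms R_def by linarith
  then show ?thesis by (simp only: u_def v_def P_def R_def right_diff_distrib)
qed

subsection \<open>Degrees\<close>

lemma degU_insert:
  assumes "finite G" "(i, j) \<notin> G"
  shows "degU (insert (i, j) G) x = degU G x + of_bool (x = i)"
proof -
  have fin: "finite {y. (x, y) \<in> G}"
    by (rule finite_subset[of _ "snd ` G"]) (use assms in force)+
  show ?thesis
  proof (cases "x = i")
    case True
    have "{y. (x, y) \<in> insert (i, j) G} = insert j {y. (x, y) \<in> G}" using True by auto
    then show ?thesis using fin assms True by (simp add: degU_def)
  qed (simp add: degU_def)
qed

lemma degV_insert:
  assumes "finite G" "(i, j) \<notin> G"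
  shows "degV (insert (i, j) G) y = degV G y + of_bool (y = j)"
proof -
  have fin: "finite {x. (x, y) \<in> G}"
    by (rule finite_subset[of _ "fst ` G"]) (use assms in force)+
  show ?thesis
  proof (cases "y = j")
    case True
    have "{x. (x, y) \<in> insert (i, j) G} = insert i {x. (x, y) \<in> G}" using True by auto
    then show ?thesis using fin assms True by (simp add: degV_def)
  qed (simp add: degV_def)
qed

lemma deg_empty [simp]: "degU {} x = 0" "degV {} y = 0"
  by (simp_all add: degU_def degV_def)

lemma degU_Un_disjoint:
  assumes "finite G" "finite H" "G \<inter> H = {}"
  shows "degU (G \<union> H) x = degU G x + degU H x"
  using assms(2,3)
proof (induction H rule: finite_induct)
  case (insert p H)
  then show ?case using assms(1) by (cases p) (simp add: degU_insert)
qed simp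

lemma degV_Un_disjoint:
  assumes "finite G" "finite H" "G \<inter> H = {}"
  shows "degV (G \<union> H) y = degV G y + degV H y"
  using assms(2,3)
proof (induction H rule: finite_induct)
  case (insert p H)
  then show ?case using assms(1) by (cases p) (simp add: degV_insert)
qed simp

text \<open>Double counting through the end of each edge on the first side. The weight
  \<open>f\<close> is 1 for counting edges and the degree in another graph for counting adjacent
  pairs of edges.\<close>

lemma sum_degU:
  assumes "finite E" "finite I"
  shows "(\<Sum>a\<in>I. degU E a * f a) = (\<Sum>p\<in>{p\<in>E. fst p \<in> I}. f (fst p))"
  using assms(1)
proof (induction E rule: finite_induct)
  case (insert p E)
  have "{q \<in> insert p E. fst q \<in> I} = (if fst p \<in> I then insert p {q\<in>E. fst q \<in> I} else {q\<in>E. fst q \<in> I})"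
    by auto
  then show ?case using insert assms(2)
    by (cases p) (auto simp: degU_insert distrib_right sum.distrib of_bool_def if_distrib[of "\<lambda>x. x * _"] cong: if_cong)
qed simp

lemma sum_degV:
  assumes "finite E" "finite J"
  shows "(\<Sum>b\<in>J. degV E b * f b) = (\<Sum>p\<in>{p\<in>E. snd p \<in> J}. f (snd p))"
  using assms(1)
proof (induction E rule: finite_induct)
  case (insert p E)
  have "{q \<in> insert p E. snd q \<in> J} = (if snd p \<in> J then insert p {q\<in>E. snd q \<in> J} else {q\<in>E. snd q \<in> J})"
    by auto
  then show ?case using insert assms(2)
    by (cases p) (auto simp: degV_insert distrib_right sum.distrib of_bool_def if_distrib[of "\<lambda>x. x * _"] cong: if_cong)
qed simp

lemma finite_nbrs:
  assumes "finite E" shows "finite {b. (a, b) \<in> E}" "finite {a. (a, b) \<in> E}"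
proof -
  show "finite {b. (a, b) \<in> E}" by (rule finite_subset[of _ "snd ` E"]) (use assms in force)+
  show "finite {a. (a, b) \<in> E}" by (rule finite_subset[of _ "fst ` E"]) (use assms in force)+
qed

lemma card_edges_fst_le:
  assumes "finite E" "finite I" "\<And>a. a \<in> I \<Longrightarrow> degU E a \<le> B"
  shows "card {p\<in>E. fst p \<in> I} \<le> card I * B"
proof -
  have "card {p\<in>E. fst p \<in> I} = (\<Sum>a\<in>I. degU E a)"
    using sum_degU[OF assms(1,2), of "\<lambda>_. 1"] by simp
  also have "\<dots> \<le> card I * B" using sum_bounded_above[of I "degU E" B] assms(3) by simp
  finally show ?thesis .
qed

lemma card_edges_snd_le:
  assumes "finite E" "finite J" "\<And>b. b \<in> J \<Longrightarrow> degV E b \<le> B"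
  shows "card {p\<in>E. snd p \<in> J} \<le> card J * B"
proof -
  have "card {p\<in>E. snd p \<in> J} = (\<Sum>b\<in>J. degV E b)"
    using sum_degV[OF assms(1,2), of "\<lambda>_. 1"] by simp
  also have "\<dots> \<le> card J * B" using sum_bounded_above[of J "degV E" B] assms(3) by simp
  finally show ?thesis .
qed

text \<open>Group the pairs by the joining element \<open>(a, d)\<close> of \<open>Y\<close>: then
  \<open>p\<close> is any edge at \<open>a\<close> and \<open>q\<close> any edge at
  \<open>d\<close>, independently. With \<open>Y\<close> inside \<open>X\<close> this is the source
  of the correction \<open>F / S\<^sup>2\<close>.\<close>

lemma card_edge_pairs_joined:
  assumes "finite E" "finite Y"
  shows "card {(p, q). p \<in> E \<and> q \<in> E \<and> (fst p, snd q) \<in> Y} = (\<Sum>(a, d)\<in>Y. degU E a * degV E d)"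
proof -
  let ?T = "SIGMA y:Y. {b. (fst y, b) \<in> E} \<times> {c. (c, snd y) \<in> E}"
  have "{(p, q). p \<in> E \<and> q \<in> E \<and> (fst p, snd q) \<in> Y} = (\<lambda>(y, b, c). ((fst y, b), (c, snd y))) ` ?T"
    by (force simp: image_iff)
  moreover have "inj_on (\<lambda>(y, b, c). ((fst y, b), (c, snd y))) ?T" by (auto simp: inj_on_def)
  ultimately have "card {(p, q). p \<in> E \<and> q \<in> E \<and> (fst p, snd q) \<in> Y} = card ?T" by (simp add: card_image)
  also have "\<dots> = (\<Sum>y\<in>Y. degU E (fst y) * degV E (snd y))"
    using assms by (subst card_SigmaI) (auto simp: finite_nbrs card_cartesian_product degU_def degV_def)
  finally show ?thesis by (simp add: case_prod_beta)
qed

text \<open>The common core of all switchings: exchanging two edge sets with the same degrees at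
  every vertex preserves both degree sequences.\<close>

lemma bigraphs_switch:
  assumes G: "G \<in> bigraphs m n s t" and R: "R \<subseteq> G" and A: "A \<subseteq> {1..m} \<times> {1..n}" "A \<inter> G = {}"
    and deg: "\<And>x. degU R x = degU A x" "\<And>y. degV R y = degV A y"
  shows "G - R \<union> A \<in> bigraphs m n s t"
proof -
  have G': "G \<subseteq> {1..m} \<times> {1..n}" using G by (simp add: bigraphs_def)
  then have fin: "finite G" "finite A" "finite R"
    using A R by (meson finite_SigmaI finite_atLeastAtMost finite_subset)+
  have 1: "degU (G - R \<union> A) x = degU G x" for x
    using degU_Un_disjoint[of "G - R" A x] degU_Un_disjoint[of "G - R" R x] fin A(2) deg R
    by (auto simp: Un_absorb2 Int_Diff Int_commute)
  have 2: "degV (G - R \<union> A) x = degV G x" for x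
    using degV_Un_disjoint[of "G - R" A x] degV_Un_disjoint[of "G - R" R x] fin A(2) deg R
    by (auto simp: Un_absorb2 Int_Diff Int_commute)
  show ?thesis using G A(1) G' by (auto simp: bigraphs_def 1 2)
qed

lemma vec_max_ge: "i \<in> {1..k} \<Longrightarrow> a i \<le> vec_max k a"
  unfolding vec_max_def by (rule Max_ge) auto

section \<open>Degree and weight bounds relative to a fixed forbidden graph\<close>

locale forbidden_edges =
  fixes m n :: nat and s t :: "nat \<Rightarrow> nat" and X :: bigraph
  assumes X_sub: "X \<subseteq> {1..m} \<times> {1..n}"
begin

abbreviation "graphs \<equiv> bigraphs m n s t"
abbreviation "smax \<equiv> vec_max m s"
abbreviation "tmax \<equiv> vec_max n t"
abbreviation "xmax \<equiv> vec_max m (degU X)"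
abbreviation "ymax \<equiv> vec_max n (degV X)"
abbreviation "\<Delta> \<equiv> delta_max m n s t X"
abbreviation "F \<equiv> forbidden_weight s t X"
abbreviation "S \<equiv> \<Sum>i=1..m. s i"

lemma finite_X [simp]: "finite X"
  using X_sub by (rule finite_subset) simp

lemma finite_graphs [simp]: "finite graphs"
  by (rule finite_subset[of _ "Pow ({1..m} \<times> {1..n})"]) (auto simp: bigraphs_def)

lemma graphs_sub: "G \<in> graphs \<Longrightarrow> G \<subseteq> {1..m} \<times> {1..n}"
  by (simp add: bigraphs_def)

lemma finite_graph: "G \<in> graphs \<Longrightarrow> finite G"
  using graphs_sub finite_subset by blast

lemma degU_graph: "G \<in> graphs \<Longrightarrow> i \<in> {1..m} \<Longrightarrow> degU G i = s i"
  and degV_graph: "G \<in> graphs \<Longrightarrow> j \<in> {1..n} \<Longrightarrow> degV G j = t j"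
  by (auto simp: bigraphs_def)

lemma degU_outside: "G \<subseteq> {1..m} \<times> {1..n} \<Longrightarrow> i \<notin> {1..m} \<Longrightarrow> degU G i = 0"
  and degV_outside: "G \<subseteq> {1..m} \<times> {1..n} \<Longrightarrow> j \<notin> {1..n} \<Longrightarrow> degV G j = 0"
proof -
  show "degU G i = 0" if "G \<subseteq> {1..m} \<times> {1..n}" "i \<notin> {1..m}"
  proof -
    have "{j. (i, j) \<in> G} = {}" using that by auto
    then show ?thesis by (simp add: degU_def)
  qed
  show "degV G j = 0" if "G \<subseteq> {1..m} \<times> {1..n}" "j \<notin> {1..n}"
  proof -
    have "{i. (i, j) \<in> G} = {}" using that by auto
    then show ?thesis by (simp add: degV_def)
  qed
qed

lemma degU_mono: "finite H \<Longrightarrow> G \<subseteq> H \<Longrightarrow> degU G i \<le> degU H i"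
  and degV_mono: "finite H \<Longrightarrow> G \<subseteq> H \<Longrightarrow> degV G j \<le> degV H j"
  unfolding degU_def degV_def by (auto intro!: card_mono finite_nbrs)

text \<open>A vertex index out of range has degree 0, so the bound holds for every \<open>i\<close>,
  even when the side is empty and the maximum unspecified.\<close>

lemma degU_le: "G \<in> graphs \<Longrightarrow> E \<subseteq> G \<Longrightarrow> degU E i \<le> smax"
  by (metis degU_graph degU_mono degU_outside finite_graph graphs_sub le_trans vec_max_ge zero_le)

lemma degV_le: "G \<in> graphs \<Longrightarrow> E \<subseteq> G \<Longrightarrow> degV E j \<le> tmax"
  by (metis degV_graph degV_mono degV_outside finite_graph graphs_sub le_trans vec_max_ge zero_le)

lemma degX_le: "degU X i \<le> xmax" "degV X j \<le> ymax"
  by (metis degU_outside X_sub vec_max_ge zero_le) (metis degV_outside X_sub vec_max_ge zero_le)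

lemma card_graph:
  assumes "G \<in> graphs" shows "card G = S"
proof -
  have "{p \<in> G. fst p \<in> {1..m}} = G" using graphs_sub[OF assms] by auto
  then show ?thesis
    using sum_degU[OF finite_graph[OF assms], of "{1..m}" "\<lambda>_. 1"] assms by (simp add: degU_graph)
qed

text \<open>This bounds the auxiliary edges blocked because a new pair is already in
  \<open>G \<union> X\<close>. A vertex has at most \<open>smax + xmax\<close> (or
  \<open>tmax + ymax\<close>) neighbours in \<open>G \<union> X\<close>, each carrying at most
  \<open>tmax\<close> (or \<open>smax\<close>) edges, and both products are at most
  \<Delta>.\<close>

lemma card_edges_at_le:
  assumes G: "G \<in> graphs" and E: "E \<subseteq> G"
  shows "card {p\<in>E. (i, snd p) \<in> G \<union> X} \<le> \<Delta>" "card {p\<in>E. (fst p, j) \<in> G \<union> X} \<le> \<Delta>"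
proof -
  have fin: "finite E" "finite (G \<union> X)" using E finite_graph[OF G] finite_subset by auto
  have "card {p\<in>E. (i, snd p) \<in> G \<union> X} = card {p\<in>E. snd p \<in> {b. (i, b) \<in> G \<union> X}}" by simp
  also have "\<dots> \<le> card {b. (i, b) \<in> G \<union> X} * tmax"
    by (intro card_edges_snd_le fin finite_nbrs degV_le[OF G E])
  also have "card {b. (i, b) \<in> G \<union> X} \<le> degU G i + degU X i"
    unfolding degU_def by (simp only: Un_iff Collect_disj_eq card_Un_le)
  also have "\<dots> \<le> smax + xmax"
    by (intro add_mono degU_le[OF G order_refl] degX_le)
  finally show "card {p\<in>E. (i, snd p) \<in> G \<union> X} \<le> \<Delta>"
    by (auto simp: delta_max_def algebra_simps intro: order_trans)
  have "card {p\<in>E. (fst p, j) \<in> G \<union> X} = card {p\<in>E. fst p \<in> {a. (a, j) \<in> G \<union> X}}" by simp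
  also have "\<dots> \<le> card {a. (a, j) \<in> G \<union> X} * smax"
    by (intro card_edges_fst_le fin finite_nbrs degU_le[OF G E])
  also have "card {a. (a, j) \<in> G \<union> X} \<le> degV G j + degV X j"
    unfolding degV_def by (simp only: Un_iff Collect_disj_eq card_Un_le)
  also have "\<dots> \<le> tmax + ymax"
    by (intro add_mono degV_le[OF G order_refl] degX_le)
  finally show "card {p\<in>E. (fst p, j) \<in> G \<union> X} \<le> \<Delta>"
    by (auto simp: delta_max_def algebra_simps intro: order_trans)
qed

lemma forbidden_weight_alt: "F = (\<Sum>p\<in>X. s (fst p) * t (snd p))"
  by (simp add: forbidden_weight_def case_prod_beta)

text \<open>Replacing \<open>s\<close>, \<open>t\<close> by the degrees outside \<open>X\<close>
  costs \<open>xmax * tmax + smax * ymax\<close> per edge of \<open>G \<inter> X\<close>, as such an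
  edge shares its ends with at most \<open>xmax\<close> and \<open>ymax\<close> pairs of
  \<open>X\<close>. Leaving out the pairs of \<open>X\<close> that lie in \<open>G\<close> costs
  \<open>smax * tmax\<close> each. These are the three summands of \<Delta>.\<close>

lemma sum_degree_products_ge:
  assumes G: "G \<in> graphs"
  shows "F \<le> (\<Sum>p\<in>X - G. degU (G - X) (fst p) * degV (G - X) (snd p)) + card (G \<inter> X) * \<Delta>"
proof -
  define W where "W = G \<inter> X"
  have finG: "finite G" using G by (rule finite_graph)
  have W: "finite W" "W \<subseteq> X" "W \<subseteq> G" using finG by (auto simp: W_def)
  have GW: "(G - X) \<union> W = G" "(G - X) \<inter> W = {}" by (auto simp: W_def)
  have prod: "s (fst p) * t (snd p) \<le> degU (G - X) (fst p) * degV (G - X) (snd p)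
      + degU W (fst p) * tmax + smax * degV W (snd p)" if "p \<in> X" for p
  proof -
    have p: "fst p \<in> {1..m}" "snd p \<in> {1..n}" using X_sub that by auto
    have 1: "s (fst p) = degU (G - X) (fst p) + degU W (fst p)"
      using degU_Un_disjoint[of "G - X" W] finG W GW degU_graph[OF G p(1)] by simp
    have 2: "t (snd p) = degV (G - X) (snd p) + degV W (snd p)"
      using degV_Un_disjoint[of "G - X" W] finG W GW degV_graph[OF G p(2)] by simp
    have "degU W (fst p) * t (snd p) \<le> degU W (fst p) * tmax"
      by (intro mult_left_mono vec_max_ge p) simp
    moreover have "degU (G - X) (fst p) * degV W (snd p) \<le> smax * degV W (snd p)"
      by (intro mult_right_mono degU_le[OF G]) auto
    moreover have "s (fst p) * t (snd p) = degU (G - X) (fst p) * degV (G - X) (snd p)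
      + degU W (fst p) * t (snd p) + degU (G - X) (fst p) * degV W (snd p)"
      unfolding 1 2 by (simp add: algebra_simps)
    ultimately show ?thesis by linarith
  qed
  have "(\<Sum>p\<in>X. degU W (fst p)) = (\<Sum>i=1..m. degU X i * degU W i)"
  proof -
    have "{p\<in>X. fst p \<in> {1..m}} = X" using X_sub by auto
    then show ?thesis using sum_degU[of X "{1..m}" "degU W"] by simp
  qed
  also have "\<dots> \<le> (\<Sum>i=1..m. xmax * degU W i)" by (intro sum_mono mult_right_mono degX_le) simp
  also have "\<dots> = xmax * card W"
  proof -
    have "{p\<in>W. fst p \<in> {1..m}} = W" using X_sub W by auto
    then show ?thesis using sum_degU[OF W(1), of "{1..m}" "\<lambda>_. 1"] by (simp flip: sum_distrib_left)
  qed
  finally have U: "(\<Sum>p\<in>X. degU W (fst p)) \<le> xmax * card W" .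
  have "(\<Sum>p\<in>X. degV W (snd p)) = (\<Sum>j=1..n. degV X j * degV W j)"
  proof -
    have "{p\<in>X. snd p \<in> {1..n}} = X" using X_sub by auto
    then show ?thesis using sum_degV[of X "{1..n}" "degV W"] by simp
  qed
  also have "\<dots> \<le> (\<Sum>j=1..n. ymax * degV W j)" by (intro sum_mono mult_right_mono degX_le) simp
  also have "\<dots> = ymax * card W"
  proof -
    have "{p\<in>W. snd p \<in> {1..n}} = W" using X_sub W by auto
    then show ?thesis using sum_degV[OF W(1), of "{1..n}" "\<lambda>_. 1"] by (simp flip: sum_distrib_left)
  qed
  finally have V: "(\<Sum>p\<in>X. degV W (snd p)) \<le> ymax * card W" .
  have "F = (\<Sum>p\<in>X - G. s (fst p) * t (snd p)) + (\<Sum>p\<in>W. s (fst p) * t (snd p))"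
    unfolding forbidden_weight_alt W_def Int_commute[of G X] add.commute[of "sum _ (X - G)"]
    by (rule sum.Int_Diff) simp
  also have "(\<Sum>p\<in>W. s (fst p) * t (snd p)) \<le> (\<Sum>p\<in>W. smax * tmax)"
    using X_sub W(2) by (intro sum_mono mult_mono vec_max_ge) auto
  also have "(\<Sum>p\<in>X - G. s (fst p) * t (snd p)) \<le> (\<Sum>p\<in>X - G. degU (G - X) (fst p) * degV (G - X) (snd p)
      + degU W (fst p) * tmax + smax * degV W (snd p))"
    by (intro sum_mono prod) auto
  also have "\<dots> = (\<Sum>p\<in>X - G. degU (G - X) (fst p) * degV (G - X) (snd p))
      + (\<Sum>p\<in>X - G. degU W (fst p)) * tmax + smax * (\<Sum>p\<in>X - G. degV W (snd p))"
    by (simp add: sum.distrib sum_distrib_left sum_distrib_right)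
  also have "(\<Sum>p\<in>X - G. degU W (fst p)) \<le> xmax * card W"
    by (rule order_trans[OF sum_mono2 U]) auto
  also have "(\<Sum>p\<in>X - G. degV W (snd p)) \<le> ymax * card W"
    by (rule order_trans[OF sum_mono2 V]) auto
  finally show ?thesis by (simp add: delta_max_def W_def algebra_simps)
qed

end

subsection \<open>The three-edge switching\<close>

definition old_edges :: "(nat \<times> nat) \<times> (nat \<times> nat) \<times> (nat \<times> nat) \<Rightarrow> bigraph" where
  "old_edges = (\<lambda>(e, p, q). {e, p, q})"

definition new_edges :: "(nat \<times> nat) \<times> (nat \<times> nat) \<times> (nat \<times> nat) \<Rightarrow> bigraph" where
  "new_edges = (\<lambda>(e, p, q). {(fst e, snd p), (fst q, snd e), (fst p, snd q)})"

text \<open>With distinct ends, both sets are perfect matchings of the same six vertices.\<close>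

lemma deg_old_new_edges:
  assumes "fst e \<noteq> fst p" "fst e \<noteq> fst q" "fst p \<noteq> fst q"
    "snd e \<noteq> snd p" "snd e \<noteq> snd q" "snd p \<noteq> snd q"
  shows "degU (old_edges (e, p, q)) x = degU (new_edges (e, p, q)) x"
    "degV (old_edges (e, p, q)) x = degV (new_edges (e, p, q)) x"
  using assms
  by (cases e; cases p; cases q; auto simp: old_edges_def new_edges_def degU_insert degV_insert)+

context forbidden_edges
begin

text \<open>
  In a tuple \<open>(e, p, q)\<close> the entries are \<open>e = (i, j)\<close>, \<open>p = (a, b)\<close>, \<open>q = (c, d)\<close>. A second auxiliary edge \<open>q\<close>
  is needed: in the switching with \<open>e\<close> and \<open>p\<close> alone, the condition \<open>p \<notin> H \<union> X\<close> may exclude most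
  reverse moves for some \<open>e\<close>, whereas here it only constrains the edge \<open>(a, d)\<close> of \<open>H\<close>.
\<close>

definition forward :: "bigraph \<Rightarrow> ((nat \<times> nat) \<times> (nat \<times> nat) \<times> (nat \<times> nat)) set" where
  "forward G = {(e, p, q). e \<in> G \<inter> X \<and> p \<in> G - X \<and> q \<in> G - X \<and>
     (fst e, snd p) \<notin> G \<union> X \<and> (fst q, snd e) \<notin> G \<union> X \<and> (fst p, snd q) \<notin> G \<union> X}"

text \<open>A reverse move is labelled by the edges it restores, not by those it removes, so a move
  and its inverse carry the same triple.\<close>

definition backward :: "bigraph \<Rightarrow> ((nat \<times> nat) \<times> (nat \<times> nat) \<times> (nat \<times> nat)) set" where
  "backward H = {(e, p, q). e \<in> X - H \<and> p \<notin> H \<union> X \<and> q \<notin> H \<union> X \<and>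
     (fst e, snd p) \<in> H - X \<and> (fst q, snd e) \<in> H - X \<and> (fst p, snd q) \<in> H - X}"

definition level :: "nat \<Rightarrow> bigraph set" where
  "level k = {G \<in> graphs. card (G \<inter> X) = k}"

text \<open>If two ends on one side coincided, a new edge would equal an old one, whereas exactly
  one of the two edge sets lies in the graph.\<close>

lemma distinct_ends:
  assumes "(e, p, q) \<in> forward G \<or> (e, p, q) \<in> backward G"
  shows "fst e \<noteq> fst p" "fst e \<noteq> fst q" "fst p \<noteq> fst q"
    "snd e \<noteq> snd p" "snd e \<noteq> snd q" "snd p \<noteq> snd q"
proof -
  obtain i j a b c d where "e = (i, j)" "p = (a, b)" "q = (c, d)" by (metis prod.exhaust)
  then show "fst e \<noteq> fst p" "fst e \<noteq> fst q" "fst p \<noteq> fst q"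
    "snd e \<noteq> snd p" "snd e \<noteq> snd q" "snd p \<noteq> snd q"
    using assms by (auto simp: forward_def backward_def)
qed

lemma forward_edges:
  assumes "\<tau> \<in> forward G"
  shows "old_edges \<tau> \<subseteq> G" "new_edges \<tau> \<inter> G = {}" "new_edges \<tau> \<inter> X = {}"
    "old_edges \<tau> \<inter> X = {fst \<tau>}"
  using assms by (auto simp: forward_def old_edges_def new_edges_def)

lemma backward_edges:
  assumes "\<tau> \<in> backward H"
  shows "new_edges \<tau> \<subseteq> H" "old_edges \<tau> \<inter> H = {}" "new_edges \<tau> \<inter> X = {}"
    "old_edges \<tau> \<inter> X = {fst \<tau>}"
  using assms by (auto simp: backward_def old_edges_def new_edges_def)

lemma forward_switch:
  assumes G: "G \<in> level (Suc k)" and \<tau>: "\<tau> \<in> forward G"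
  defines "H \<equiv> G - old_edges \<tau> \<union> new_edges \<tau>"
  shows "H \<in> level k" "\<tau> \<in> backward H"
proof -
  obtain e p q where epq: "\<tau> = (e, p, q)" by (metis prod.exhaust)
  note T = forward_edges[OF \<tau>]
  have G': "G \<in> graphs" "card (G \<inter> X) = Suc k" using G by (auto simp: level_def)
  have "new_edges \<tau> \<subseteq> {1..m} \<times> {1..n}"
    using \<tau> graphs_sub[OF G'(1)] by (fastforce simp: forward_def new_edges_def)
  then have "H \<in> graphs" unfolding H_def
    using G' T deg_old_new_edges[of e p q] distinct_ends[of e p q G] \<tau>
    by (intro bigraphs_switch) (auto simp: epq)
  moreover have "H \<inter> X = G \<inter> X - {e}" and "e \<in> G \<inter> X" using T epq unfolding H_def by auto
  then have "card (H \<inter> X) = k" using G' by simp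
  ultimately show "H \<in> level k" by (simp add: level_def)
  show "\<tau> \<in> backward H"
    using \<tau> unfolding H_def by (auto simp: backward_def forward_def old_edges_def new_edges_def)
qed

lemma backward_switch:
  assumes H: "H \<in> level k" and \<tau>: "\<tau> \<in> backward H"
  defines "G \<equiv> H - new_edges \<tau> \<union> old_edges \<tau>"
  shows "G \<in> level (Suc k)" "\<tau> \<in> forward G"
proof -
  obtain e p q where epq: "\<tau> = (e, p, q)" by (metis prod.exhaust)
  note T = backward_edges[OF \<tau>]
  have H': "H \<in> graphs" "card (H \<inter> X) = k" using H by (auto simp: level_def)
  have "old_edges \<tau> \<subseteq> {1..m} \<times> {1..n}"
    using \<tau> X_sub graphs_sub[OF H'(1)] by (fastforce simp: backward_def old_edges_def)
  then have "G \<in> graphs" unfolding G_def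
    using H' T deg_old_new_edges[of e p q] distinct_ends[of e p q H] \<tau>
    by (intro bigraphs_switch) (auto simp: epq)
  moreover have "G \<inter> X = insert e (H \<inter> X)" and "e \<notin> H \<inter> X" using T epq unfolding G_def by auto
  then have "card (G \<inter> X) = Suc k" using H' by simp
  ultimately show "G \<in> level (Suc k)" by (simp add: level_def)
  show "\<tau> \<in> forward G"
    using \<tau> unfolding G_def by (auto simp: backward_def forward_def old_edges_def new_edges_def)
qed

lemma finite_level [simp]: "finite (level k)"
  by (simp add: level_def)

lemma finite_forward: "G \<in> graphs \<Longrightarrow> finite (forward G)"
  by (rule finite_subset[of _ "G \<times> G \<times> G"]) (auto simp: forward_def finite_graph)

lemma finite_backward: "H \<in> graphs \<Longrightarrow> finite (backward H)"
proof (rule finite_subset[of _ "X \<times> ({1..m} \<times> {1..n}) \<times> ({1..m} \<times> {1..n})"])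
  assume "H \<in> graphs"
  then show "backward H \<subseteq> X \<times> ({1..m} \<times> {1..n}) \<times> ({1..m} \<times> {1..n})"
    using graphs_sub by (fastforce simp: backward_def)
qed auto

text \<open>Switching changes the graph and keeps the triple, and it is undone by exchanging the
  same two edge sets; so pairs of a graph and a move on the two levels are in bijection.\<close>

lemma sum_forward_eq_sum_backward:
  "(\<Sum>G\<in>level (Suc k). card (forward G)) = (\<Sum>H\<in>level k. card (backward H))"
proof -
  have swap: "G - A \<union> B - B \<union> A = G" if "A \<subseteq> G" "B \<inter> G = {}" for G A B :: bigraph
    using that by blast
  have "bij_betw (\<lambda>(G, \<tau>). (G - old_edges \<tau> \<union> new_edges \<tau>, \<tau>))
      (SIGMA G:level (Suc k). forward G) (SIGMA H:level k. backward H)"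
  proof (rule bij_betw_byWitness[where f' = "\<lambda>(H, \<tau>). (H - new_edges \<tau> \<union> old_edges \<tau>, \<tau>)"])
    show "\<forall>x\<in>SIGMA G:level (Suc k). forward G.
        (\<lambda>(H, \<tau>). (H - new_edges \<tau> \<union> old_edges \<tau>, \<tau>)) ((\<lambda>(G, \<tau>). (G - old_edges \<tau> \<union> new_edges \<tau>, \<tau>)) x) = x"
      using swap[OF forward_edges(1,2)] by (simp add: split_paired_all)
    show "\<forall>x\<in>SIGMA H:level k. backward H.
        (\<lambda>(G, \<tau>). (G - old_edges \<tau> \<union> new_edges \<tau>, \<tau>)) ((\<lambda>(H, \<tau>). (H - new_edges \<tau> \<union> old_edges \<tau>, \<tau>)) x) = x"
      using swap[OF backward_edges(1,2)] by (simp add: split_paired_all)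
  qed (use forward_switch backward_switch in auto)
  then have "card (SIGMA G:level (Suc k). forward G) = card (SIGMA H:level k. backward H)"
    by (rule bij_betw_same_card)
  then show ?thesis
    by (simp add: card_SigmaI finite_forward finite_backward level_def)
qed

text \<open>There are \<open>k\<close> choices of \<open>e\<close> and
  \<open>(S - k)\<^sup>2\<close> of \<open>(p, q)\<close>. Conflicts at the two ends of
  \<open>e\<close>, and \<open>(a, d)\<close> in \<open>G\<close>, each exclude at most
  \<open>S * \<Delta>\<close> pairs; \<open>(a, d)\<close> in \<open>X\<close> excludes at most
  \<open>F\<close>. The upper bound subtracts only the last kind. All terms are arranged as sums to
  avoid truncated subtraction of error terms.\<close>

lemma forward_bounds:
  assumes G: "G \<in> level k"
  shows "k * (S - k)\<^sup>2 \<le> card (forward G) + k * (F + 3 * S * \<Delta>)"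
    "card (forward G) + k * F \<le> k * (S - k)\<^sup>2 + k * (k * \<Delta>)"
proof -
  have G': "G \<in> graphs" "card (G \<inter> X) = k" using G by (auto simp: level_def)
  note finG = finite_graph[OF G'(1)]
  define E where "E = G - X"
  have E: "finite E" "E \<subseteq> G" using finG by (auto simp: E_def)
  have cE: "card E = S - k" unfolding E_def
    using card_Diff_subset_Int[of G X] finG G' card_graph[OF G'(1)] by simp
  define Q where "Q e = {(p, q). p \<in> E \<and> q \<in> E \<and> (fst e, snd p) \<notin> G \<union> X \<and> (fst q, snd e) \<notin> G \<union> X \<and> (fst p, snd q) \<notin> G \<union> X}"
    for e
  have Q_sub: "Q e \<subseteq> E \<times> E" for e by (auto simp: Q_def)
  then have finQ: "finite (Q e)" for e using E(1) by (meson finite_SigmaI finite_subset)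
  have "forward G = (SIGMA e:G \<inter> X. Q e)" by (auto simp: forward_def Q_def E_def)
  then have cf: "card (forward G) = (\<Sum>e\<in>G \<inter> X. card (Q e))"
    using finQ finG by (simp add: card_SigmaI)
  have sq: "card (E \<times> E) = (S - k)\<^sup>2" by (simp add: card_cartesian_product cE power2_eq_square)
  have low: "(S - k)\<^sup>2 \<le> card (Q e) + (F + 3 * S * \<Delta>)" for e
  proof -
    let ?B1 = "{p\<in>E. (fst e, snd p) \<in> G \<union> X} \<times> E"
    let ?B2 = "E \<times> {q\<in>E. (fst q, snd e) \<in> G \<union> X}"
    let ?B3 = "{(p, q). p \<in> E \<and> q \<in> E \<and> (fst p, snd q) \<in> G}"
    let ?B4 = "{(p, q). p \<in> E \<and> q \<in> E \<and> (fst p, snd q) \<in> X}"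
    have fin: "finite ?B1" "finite ?B2" "finite ?B3" "finite ?B4"
      using E(1) by (auto intro: finite_subset[of _ "E \<times> E"])
    have "E \<times> E \<subseteq> Q e \<union> (?B1 \<union> (?B2 \<union> (?B3 \<union> ?B4)))" by (auto simp: Q_def)
    then have "card (E \<times> E) \<le> card (Q e \<union> (?B1 \<union> (?B2 \<union> (?B3 \<union> ?B4))))"
      by (intro card_mono) (use fin finQ in auto)
    also have "\<dots> \<le> card (Q e) + (card ?B1 + (card ?B2 + (card ?B3 + card ?B4)))"
      by (intro order_trans[OF card_Un_le] add_left_mono order_refl)
    finally have 1: "(S - k)\<^sup>2 \<le> card (Q e) + (card ?B1 + (card ?B2 + (card ?B3 + card ?B4)))" unfolding sq .
    have 2: "card ?B1 \<le> \<Delta> * S" "card ?B2 \<le> S * \<Delta>"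
      unfolding card_cartesian_product cE using card_edges_at_le[OF G'(1) E(2)] by (auto intro!: mult_mono)
    have "card ?B3 = (\<Sum>(a, d)\<in>G. degU E a * degV E d)" by (rule card_edge_pairs_joined[OF E(1) finG])
    also have "\<dots> \<le> (\<Sum>(a, d)\<in>G. \<Delta>)"
    proof (rule sum_mono)
      fix y assume "y \<in> G"
      have "degU E (fst y) * degV E (snd y) \<le> smax * tmax"
        by (intro mult_mono degU_le[OF G'(1) E(2)] degV_le[OF G'(1) E(2)]) auto
      then show "(case y of (a, d) \<Rightarrow> degU E a * degV E d) \<le> (case y of (a, d) \<Rightarrow> \<Delta>)"
        by (simp add: case_prod_beta delta_max_def)
    qed
    also have "\<dots> = S * \<Delta>" using card_graph[OF G'(1)] by simp
    finally have 3: "card ?B3 \<le> S * \<Delta>" .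
    have "card ?B4 = (\<Sum>(a, d)\<in>X. degU E a * degV E d)" by (rule card_edge_pairs_joined[OF E(1) finite_X])
    also have "\<dots> \<le> F" unfolding forbidden_weight_def
    proof (rule sum_mono)
      fix y assume y: "y \<in> X"
      have "degU E (fst y) * degV E (snd y) \<le> degU G (fst y) * degV G (snd y)"
        by (intro mult_mono degU_mono degV_mono finG E) auto
      then show "(case y of (a, d) \<Rightarrow> degU E a * degV E d) \<le> (case y of (a, d) \<Rightarrow> s a * t d)"
        using y X_sub by (auto simp: degU_graph[OF G'(1)] degV_graph[OF G'(1)])
    qed
    finally show ?thesis using 1 2 3 by (simp add: algebra_simps)
  qed
  have "k * (S - k)\<^sup>2 \<le> (\<Sum>e\<in>G \<inter> X. card (Q e) + (F + 3 * S * \<Delta>))"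
    using sum_mono[of "G \<inter> X" "\<lambda>_. (S - k)\<^sup>2" "\<lambda>e. card (Q e) + (F + 3 * S * \<Delta>)"] low G'(2) by simp
  then show "k * (S - k)\<^sup>2 \<le> card (forward G) + k * (F + 3 * S * \<Delta>)"
    using G'(2) by (simp add: cf sum.distrib)
  have up: "card (Q e) + F \<le> (S - k)\<^sup>2 + k * \<Delta>" for e
  proof -
    \<comment> \<open>Restricting to \<open>X - G\<close> matches
      \<open>sum_degree_products_ge\<close>, so that at least \<open>F - k * \<Delta>\<close> pairs
      are excluded.\<close>
    let ?B = "{(p, q). p \<in> E \<and> q \<in> E \<and> (fst p, snd q) \<in> X - G}"
    have "finite ?B" using E(1) by (auto intro: finite_subset[of _ "E \<times> E"])
    moreover have "Q e \<inter> ?B = {}" by (auto simp: Q_def)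
    ultimately have "card (Q e) + card ?B = card (Q e \<union> ?B)" using finQ by (simp add: card_Un_disjoint)
    also have "\<dots> \<le> card (E \<times> E)" using E(1) Q_sub by (intro card_mono) auto
    finally have "card (Q e) + card ?B \<le> (S - k)\<^sup>2" unfolding sq .
    moreover have "card ?B = (\<Sum>(a, d)\<in>X - G. degU E a * degV E d)"
      by (rule card_edge_pairs_joined) (use E(1) in auto)
    ultimately show ?thesis
      using sum_degree_products_ge[OF G'(1)] G'(2) by (simp add: E_def case_prod_beta)
  qed
  have "(\<Sum>e\<in>G \<inter> X. card (Q e) + F) \<le> k * ((S - k)\<^sup>2 + k * \<Delta>)"
    using sum_mono[of "G \<inter> X" "\<lambda>e. card (Q e) + F" "\<lambda>_. (S - k)\<^sup>2 + k * \<Delta>"] up G'(2) by simp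
  then show "card (forward G) + k * F \<le> k * (S - k)\<^sup>2 + k * (k * \<Delta>)"
    using G'(2) by (simp add: cf sum.distrib algebra_simps)
qed

text \<open>A reverse move is a choice of \<open>e = (i, j)\<close> in \<open>X - H\<close>, a
  neighbour \<open>b\<close> of \<open>i\<close>, a neighbour \<open>c\<close> of \<open>j\<close>,
  and an edge \<open>r = (a, d)\<close>, all edges being taken outside \<open>X\<close>. The first
  three choices number between \<open>F - k * \<Delta>\<close> and \<open>F\<close>; of the
  \<open>S - k\<close> edges \<open>r\<close>, at most \<open>2 * \<Delta>\<close> are blocked by
  \<open>(a, b)\<close> or \<open>(c, d)\<close>.\<close>

lemma backward_bounds:
  assumes H: "H \<in> level k"
  shows "card (backward H) \<le> F * (S - k)"
    "F * (S - k - 2 * \<Delta>) \<le> card (backward H) + k * \<Delta> * (S - k - 2 * \<Delta>)"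
proof -
  have H': "H \<in> graphs" "card (H \<inter> X) = k" using H by (auto simp: level_def)
  note finH = finite_graph[OF H'(1)]
  define E where "E = H - X"
  have E: "finite E" "E \<subseteq> H" using finH by (auto simp: E_def)
  have cE: "card E = S - k" unfolding E_def
    using card_Diff_subset_Int[of H X] finH H' card_graph[OF H'(1)] by simp
  define R where "R b c = {r\<in>E. (fst r, b) \<notin> H \<union> X \<and> (c, snd r) \<notin> H \<union> X}" for b c
  have finR: "finite (R b c)" for b c using E(1) by (simp add: R_def)
  define T where "T = (SIGMA e:X - H. SIGMA b:{b. (fst e, b) \<in> E}. SIGMA c:{c. (c, snd e) \<in> E}. R b c)"
  have "backward H = (\<lambda>(e, b, c, r). (e, (fst r, b), (c, snd r))) ` T"
  proof (intro equalityI subsetI)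
    fix \<tau> assume \<tau>: "\<tau> \<in> backward H"
    obtain e p q where epq: "\<tau> = (e, p, q)" by (metis prod.exhaust)
    have "(e, snd p, fst q, (fst p, snd q)) \<in> T"
      using \<tau> unfolding epq by (auto simp: T_def R_def backward_def E_def)
    then show "\<tau> \<in> (\<lambda>(e, b, c, r). (e, (fst r, b), (c, snd r))) ` T"
      unfolding epq by (rule rev_image_eqI) simp
  qed (auto simp: T_def R_def backward_def E_def)
  moreover have "inj_on (\<lambda>(e, b, c, r). (e, (fst r, b), (c, snd r))) T"
    by (auto simp: inj_on_def)
  ultimately have "card (backward H) = card T" by (simp add: card_image)
  also have "\<dots> = (\<Sum>e\<in>X - H. \<Sum>b | (fst e, b) \<in> E. \<Sum>c | (c, snd e) \<in> E. card (R b c))"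
    unfolding T_def using E(1) finR by (simp add: card_SigmaI finite_nbrs finite_SigmaI)
  finally have cb: "card (backward H) = (\<Sum>e\<in>X - H. \<Sum>b | (fst e, b) \<in> E. \<Sum>c | (c, snd e) \<in> E. card (R b c))" .
  have const: "(\<Sum>e\<in>X - H. \<Sum>b | (fst e, b) \<in> E. \<Sum>c | (c, snd e) \<in> E. K)
      = (\<Sum>e\<in>X - H. degU E (fst e) * degV E (snd e)) * K" for K :: nat
    by (simp add: degU_def degV_def sum_distrib_right mult.assoc)
  have "card (backward H) \<le> (\<Sum>e\<in>X - H. \<Sum>b | (fst e, b) \<in> E. \<Sum>c | (c, snd e) \<in> E. S - k)"
    unfolding cb cE[symmetric] by (intro sum_mono card_mono E) (auto simp: R_def)
  also have "\<dots> = (\<Sum>e\<in>X - H. degU E (fst e) * degV E (snd e)) * (S - k)" by (rule const)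
  also have "(\<Sum>e\<in>X - H. degU E (fst e) * degV E (snd e)) \<le> F"
  proof -
    have "(\<Sum>e\<in>X - H. degU E (fst e) * degV E (snd e)) \<le> (\<Sum>e\<in>X - H. s (fst e) * t (snd e))"
    proof (rule sum_mono)
      fix e assume e: "e \<in> X - H"
      have "degU E (fst e) * degV E (snd e) \<le> degU H (fst e) * degV H (snd e)"
        by (intro mult_mono degU_mono degV_mono finH E) auto
      then show "degU E (fst e) * degV E (snd e) \<le> s (fst e) * t (snd e)"
        using e X_sub by (auto simp: degU_graph[OF H'(1)] degV_graph[OF H'(1)])
    qed
    also have "\<dots> \<le> F" unfolding forbidden_weight_alt by (intro sum_mono2) auto
    finally show ?thesis .
  qed
  finally show "card (backward H) \<le> F * (S - k)" by simp
  have "(S - k - 2 * \<Delta>) \<le> card (R b c)" for b c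
  proof -
    have "E \<subseteq> R b c \<union> ({r\<in>E. (fst r, b) \<in> H \<union> X} \<union> {r\<in>E. (c, snd r) \<in> H \<union> X})"
      by (auto simp: R_def)
    then have "card E \<le> card (R b c \<union> ({r\<in>E. (fst r, b) \<in> H \<union> X} \<union> {r\<in>E. (c, snd r) \<in> H \<union> X}))"
      by (intro card_mono) (use E(1) finR in auto)
    also have "\<dots> \<le> card (R b c) + (card {r\<in>E. (fst r, b) \<in> H \<union> X} + card {r\<in>E. (c, snd r) \<in> H \<union> X})"
      by (intro order_trans[OF card_Un_le] add_left_mono order_refl)
    also have "\<dots> \<le> card (R b c) + (\<Delta> + \<Delta>)"
      by (intro add_left_mono add_mono card_edges_at_le[OF H'(1) E(2)])
    finally show ?thesis unfolding cE by simp
  qed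
  then have "(\<Sum>e\<in>X - H. \<Sum>b | (fst e, b) \<in> E. \<Sum>c | (c, snd e) \<in> E. S - k - 2 * \<Delta>) \<le> card (backward H)"
    unfolding cb by (intro sum_mono)
  then have "(\<Sum>e\<in>X - H. degU E (fst e) * degV E (snd e)) * (S - k - 2 * \<Delta>) \<le> card (backward H)"
    unfolding const .
  moreover have "F * (S - k - 2 * \<Delta>) \<le> ((\<Sum>e\<in>X - H. degU E (fst e) * degV E (snd e)) + k * \<Delta>) * (S - k - 2 * \<Delta>)"
    using sum_degree_products_ge[OF H'(1)] H'(2) by (intro mult_right_mono) (auto simp: E_def)
  ultimately show "F * (S - k - 2 * \<Delta>) \<le> card (backward H) + k * \<Delta> * (S - k - 2 * \<Delta>)"
    by (simp add: distrib_right)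
qed

subsection \<open>The mean number of forbidden edges\<close>

text \<open>The two-edge switching replaces \<open>e\<close> in \<open>G \<inter> X\<close> and
  \<open>p\<close> by the two crossing edges. Each \<open>e\<close> admits at least
  \<open>S - 2 * \<Delta>\<close> edges \<open>p\<close>, and a result is reached by at most
  \<open>F\<close> moves. Only an upper bound is wanted, so injectivity suffices and new edges may
  lie in \<open>X\<close>.\<close>

lemma first_moment_bound:
  "(\<Sum>G\<in>graphs. card (G \<inter> X)) * (S - 2 * \<Delta>) \<le> card graphs * F"
proof -
  define P where "P G = (SIGMA e:G \<inter> X. {p\<in>G. (fst e, snd p) \<notin> G \<and> (fst p, snd e) \<notin> G})" for G
  \<comment> \<open>\<open>Q\<close> records only that the two new edges are present, so each
    \<open>e = (i, j)\<close> in \<open>X\<close> contributes exactly \<open>s i * t j\<close>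
    choices and the total is \<open>F\<close> for every graph.\<close>
  define Q where "Q H = (SIGMA e:X. {p. (fst e, snd p) \<in> H \<and> (fst p, snd e) \<in> H})" for H
  let ?new = "\<lambda>(e, p). {(fst e, snd p), (fst p, snd e)} :: bigraph"
  let ?old = "\<lambda>(e, p). {e, p} :: bigraph"
  have edges: "?old \<tau> \<subseteq> G" "?new \<tau> \<inter> G = {}" if "\<tau> \<in> P G" for \<tau> G
    using that by (auto simp: P_def)
  have switch: "G - ?old \<tau> \<union> ?new \<tau> \<in> graphs" "\<tau> \<in> Q (G - ?old \<tau> \<union> ?new \<tau>)"
    if G: "G \<in> graphs" and \<tau>: "\<tau> \<in> P G" for \<tau> G
  proof -
    obtain i j a b where \<tau>_eq: "\<tau> = ((i, j), (a, b))" by (metis prod.exhaust)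
    have ne: "i \<noteq> a" "j \<noteq> b" using \<tau> by (auto simp: \<tau>_eq P_def)
    show "G - ?old \<tau> \<union> ?new \<tau> \<in> graphs"
    proof (rule bigraphs_switch[OF G edges(1)[OF \<tau>] _ edges(2)[OF \<tau>]])
      show "?new \<tau> \<subseteq> {1..m} \<times> {1..n}" using \<tau> graphs_sub[OF G] by (auto simp: \<tau>_eq P_def)
    qed (use ne in \<open>auto simp: \<tau>_eq degU_insert degV_insert\<close>)
    show "\<tau> \<in> Q (G - ?old \<tau> \<union> ?new \<tau>)" using \<tau> ne by (auto simp: \<tau>_eq P_def Q_def)
  qed
  have finP: "finite (P G)" if "G \<in> graphs" for G
    using finite_graph[OF that] by (auto simp: P_def)
  have finQ: "finite (Q H)" and cQ: "card (Q H) = F" if H: "H \<in> graphs" for H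
  proof -
    have set_eq: "{p. (fst e, snd p) \<in> H \<and> (fst p, snd e) \<in> H} = {c. (c, snd e) \<in> H} \<times> {b. (fst e, b) \<in> H}" for e
      by auto
    have fin: "finite ({c. (c, snd e) \<in> H} \<times> {b. (fst e, b) \<in> H})" for e
      using finite_nbrs[OF finite_graph[OF H]] by auto
    show "finite (Q H)" unfolding Q_def set_eq by (rule finite_SigmaI[OF finite_X fin])
    have "card (Q H) = (\<Sum>e\<in>X. degV H (snd e) * degU H (fst e))"
      unfolding Q_def set_eq using finite_nbrs[OF finite_graph[OF H]]
      by (subst card_SigmaI) (auto simp: card_cartesian_product degU_def degV_def)
    also have "\<dots> = F" unfolding forbidden_weight_alt
      using X_sub by (intro sum.cong) (auto simp: degU_graph[OF H] degV_graph[OF H])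
    finally show "card (Q H) = F" .
  qed
  have low: "card (G \<inter> X) * (S - 2 * \<Delta>) \<le> card (P G)" if G: "G \<in> graphs" for G
  proof -
    have "S - 2 * \<Delta> \<le> card {p\<in>G. (fst e, snd p) \<notin> G \<and> (fst p, snd e) \<notin> G}" (is "_ \<le> card ?R") for e
    proof -
      have "G \<subseteq> ?R \<union> ({p\<in>G. (fst e, snd p) \<in> G \<union> X} \<union> {p\<in>G. (fst p, snd e) \<in> G \<union> X})" by auto
      then have "card G \<le> card (?R \<union> ({p\<in>G. (fst e, snd p) \<in> G \<union> X} \<union> {p\<in>G. (fst p, snd e) \<in> G \<union> X}))"
        by (intro card_mono) (use finite_graph[OF G] in auto)
      also have "\<dots> \<le> card ?R + (card {p\<in>G. (fst e, snd p) \<in> G \<union> X} + card {p\<in>G. (fst p, snd e) \<in> G \<union> X})"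
        by (intro order_trans[OF card_Un_le] add_left_mono order_refl)
      also have "\<dots> \<le> card ?R + (\<Delta> + \<Delta>)"
        by (intro add_left_mono add_mono card_edges_at_le[OF G order_refl])
      finally show ?thesis unfolding card_graph[OF G] by simp
    qed
    then have "(\<Sum>e\<in>G \<inter> X. S - 2 * \<Delta>)
        \<le> (\<Sum>e\<in>G \<inter> X. card {p\<in>G. (fst e, snd p) \<notin> G \<and> (fst p, snd e) \<notin> G})"
      by (intro sum_mono)
    also have "\<dots> = card (P G)"
      unfolding P_def using finite_graph[OF G] by (simp add: card_SigmaI)
    finally show ?thesis by simp
  qed
  have swap: "G - A \<union> B - B \<union> A = G" if "A \<subseteq> G" "B \<inter> G = {}" for G A B :: bigraph
    using that by blast
  have "(\<Sum>G\<in>graphs. card (G \<inter> X)) * (S - 2 * \<Delta>) \<le> (\<Sum>G\<in>graphs. card (P G))"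
    unfolding sum_distrib_right by (intro sum_mono low)
  also have "\<dots> = card (SIGMA G:graphs. P G)" using finP by (simp add: card_SigmaI)
  also have "\<dots> \<le> card (SIGMA H:graphs. Q H)"
  proof (rule card_inj_on_le)
    show "inj_on (\<lambda>(G, \<tau>). (G - ?old \<tau> \<union> ?new \<tau>, \<tau>)) (SIGMA G:graphs. P G)"
    proof (rule inj_on_inverseI[where g = "\<lambda>(H, \<tau>). (H - ?new \<tau> \<union> ?old \<tau>, \<tau>)"])
      fix z assume "z \<in> (SIGMA G:graphs. P G)"
      then obtain G \<tau> where "z = (G, \<tau>)" "\<tau> \<in> P G" by auto
      then show "(\<lambda>(H, \<tau>). (H - ?new \<tau> \<union> ?old \<tau>, \<tau>)) ((\<lambda>(G, \<tau>). (G - ?old \<tau> \<union> ?new \<tau>, \<tau>)) z) = z"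
        using swap[OF edges] by simp
    qed
    show "(\<lambda>(G, \<tau>). (G - ?old \<tau> \<union> ?new \<tau>, \<tau>)) ` (SIGMA G:graphs. P G) \<subseteq> (SIGMA H:graphs. Q H)"
      using switch by auto
  qed (use finQ in auto)
  also have "\<dots> = card graphs * F" using finQ cQ by (simp add: card_SigmaI)
  finally show ?thesis .
qed

text \<open>Markov's inequality at \<open>S / 4\<close>: the mean is at most
  \<open>2 * F / S\<close> because \<open>S - 2 * \<Delta> \<ge> S / 2\<close>, and dividing by
  \<open>S / 4\<close> gives the factor 8.\<close>

lemma tail_bound:
  assumes "4 * \<Delta> \<le> S" "S > 0"
  shows "real (card {G \<in> graphs. S div 4 < card (G \<inter> X)}) \<le> 8 * (F / (real S)\<^sup>2) * card graphs"
proof -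
  define T where "T = {G \<in> graphs. S div 4 < card (G \<inter> X)}"
  have "real S / 4 * card T = (\<Sum>G\<in>T. real S / 4)" by simp
  also have "\<dots> \<le> (\<Sum>G\<in>T. real (card (G \<inter> X)))"
  proof (rule sum_mono)
    fix G assume "G \<in> T"
    \<comment> \<open>The strict inequality makes up for the rounding in
      \<open>S div 4\<close>.\<close>
    then have "S \<le> 4 * card (G \<inter> X)" by (auto simp: T_def)
    then have "real S \<le> real (4 * card (G \<inter> X))" by (rule of_nat_mono)
    then show "real S / 4 \<le> real (card (G \<inter> X))" by simp
  qed
  also have "\<dots> \<le> (\<Sum>G\<in>graphs. real (card (G \<inter> X)))"
    by (intro sum_mono2) (auto simp: T_def)
  finally have 1: "real S / 4 * card T \<le> (\<Sum>G\<in>graphs. real (card (G \<inter> X)))" .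
  have "real ((\<Sum>G\<in>graphs. card (G \<inter> X)) * (S - 2 * \<Delta>)) \<le> real (card graphs * F)"
    using first_moment_bound by (rule of_nat_mono)
  moreover have "real (S - 2 * \<Delta>) \<ge> real S / 2"
  proof -
    have "S \<le> 2 * (S - 2 * \<Delta>)" using assms by linarith
    then have "real S \<le> real (2 * (S - 2 * \<Delta>))" by (rule of_nat_mono)
    then show ?thesis by simp
  qed
  then have "(\<Sum>G\<in>graphs. real (card (G \<inter> X))) * (real S / 2) \<le> (\<Sum>G\<in>graphs. real (card (G \<inter> X))) * real (S - 2 * \<Delta>)"
    by (intro mult_left_mono sum_nonneg) auto
  ultimately have "(\<Sum>G\<in>graphs. real (card (G \<inter> X))) * (real S / 2) \<le> card graphs * F" by simp
  moreover have "real S / 4 * card T * (real S / 2) \<le> (\<Sum>G\<in>graphs. real (card (G \<inter> X))) * (real S / 2)"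
    using 1 by (intro mult_right_mono) (simp_all only: of_nat_0_le_iff divide_nonneg_pos zero_less_numeral)
  ultimately have "real S / 4 * card T * (real S / 2) \<le> card graphs * F" by linarith
  moreover define r where "r = real S"
  moreover have "r > 0" using assms(2) unfolding r_def by linarith
  ultimately show ?thesis unfolding T_def[symmetric] by (simp add: power2_eq_square field_simps flip: r_def)
qed

lemma card_low_levels:
  "(\<Sum>j\<le>K. card (level j)) = card {G \<in> graphs. card (G \<inter> X) \<le> K}"
proof -
  have "{G \<in> graphs. card (G \<inter> X) \<le> K} = (\<Union>j\<le>K. level j)" by (auto simp: level_def)
  also have "card \<dots> = (\<Sum>j\<le>K. card (level j))"
    by (rule card_UN_disjoint) (auto simp: level_def)
  finally show ?thesis ..
qed

lemma num_bigraphs_avoiding_eq_level_0: "num_bigraphs_avoiding m n s t X = card (level 0)"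
  unfolding num_bigraphs_avoiding_def level_def by (rule arg_cong[where f = card]) auto

subsection \<open>Ratios of consecutive levels\<close>

text \<open>Double counting of moves between levels \<open>j + 1\<close> and \<open>j\<close>: few
  forward moves are blocked, and there are at most \<open>F * (S - j)\<close> backward ones. The
  bound \<open>Suc j \<le> S\<close> makes the natural subtractions exact.\<close>

lemma level_ratio_upper:
  assumes "Suc j \<le> S"
  shows "real (Suc j) * real (card (level (Suc j))) * ((real S - real (Suc j))\<^sup>2 - F - 3 * real S * \<Delta>)
    \<le> card (level j) * (F * (real S - j))"
proof -
  have "(\<Sum>G\<in>level (Suc j). real (Suc j) * ((real S - real (Suc j))\<^sup>2 - F - 3 * real S * \<Delta>))
      \<le> (\<Sum>G\<in>level (Suc j). real (card (forward G)))"
  proof (rule sum_mono)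
    fix G assume G: "G \<in> level (Suc j)"
    have "real (Suc j * (S - Suc j)\<^sup>2) \<le> real (card (forward G) + Suc j * (F + 3 * S * \<Delta>))"
      using forward_bounds(1)[OF G] by (rule of_nat_mono)
    then show "real (Suc j) * ((real S - real (Suc j))\<^sup>2 - F - 3 * real S * \<Delta>) \<le> real (card (forward G))"
      by (simp only: of_nat_mult of_nat_add of_nat_power of_nat_diff[OF assms] of_nat_numeral) (simp only: algebra_simps)
  qed
  also have "\<dots> = (\<Sum>H\<in>level j. real (card (backward H)))"
    using sum_forward_eq_sum_backward[of j] by (metis of_nat_sum)
  also have "\<dots> \<le> (\<Sum>H\<in>level j. F * (real S - j))"
  proof (rule sum_mono)
    fix H assume H: "H \<in> level j"
    have "real (card (backward H)) \<le> real (F * (S - j))"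
      using backward_bounds(1)[OF H] by (rule of_nat_mono)
    then show "real (card (backward H)) \<le> F * (real S - j)"
      using assms by (simp only: of_nat_mult of_nat_diff[OF Suc_leD[OF assms]])
  qed
  finally show ?thesis by (simp add: mult_ac)
qed

text \<open>The same double count with the opposite bounds; \<open>j + 2 * \<Delta> \<le> S\<close>
  keeps the backward factor from being truncated.\<close>

lemma level_ratio_lower:
  assumes "Suc j \<le> S" "j + 2 * \<Delta> \<le> S"
  shows "real (Suc j) * real (card (level (Suc j))) * ((real S - real (Suc j))\<^sup>2 - F + real (Suc j) * \<Delta>)
    \<ge> card (level j) * ((real F - real j * \<Delta>) * (real S - j - 2 * \<Delta>))"
proof -
  have d: "real (S - j - 2 * \<Delta>) = real S - j - 2 * \<Delta>" using assms(2) by (simp add: of_nat_diff)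
  have "(\<Sum>H\<in>level j. (real F - real j * \<Delta>) * (real S - j - 2 * \<Delta>)) \<le> (\<Sum>H\<in>level j. real (card (backward H)))"
  proof (rule sum_mono)
    fix H assume H: "H \<in> level j"
    have "real (F * (S - j - 2 * \<Delta>)) \<le> real (card (backward H) + j * \<Delta> * (S - j - 2 * \<Delta>))"
      using backward_bounds(2)[OF H] by (rule of_nat_mono)
    then show "(real F - real j * \<Delta>) * (real S - j - 2 * \<Delta>) \<le> real (card (backward H))"
      by (simp only: of_nat_mult of_nat_add d) (simp only: algebra_simps)
  qed
  also have "\<dots> = (\<Sum>G\<in>level (Suc j). real (card (forward G)))"
    using sum_forward_eq_sum_backward[of j] by (metis of_nat_sum)
  also have "\<dots> \<le> (\<Sum>G\<in>level (Suc j). real (Suc j) * ((real S - real (Suc j))\<^sup>2 - F + real (Suc j) * \<Delta>))"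
  proof (rule sum_mono)
    fix G assume G: "G \<in> level (Suc j)"
    have "real (card (forward G) + Suc j * F) \<le> real (Suc j * (S - Suc j)\<^sup>2 + Suc j * (Suc j * \<Delta>))"
      using forward_bounds(2)[OF G] by (rule of_nat_mono)
    then show "real (card (forward G)) \<le> real (Suc j) * ((real S - real (Suc j))\<^sup>2 - F + real (Suc j) * \<Delta>)"
      by (simp only: of_nat_mult of_nat_add of_nat_power of_nat_diff[OF assms(1)] of_nat_numeral) (simp only: algebra_simps)
  qed
  finally show ?thesis by (simp add: mult_ac)
qed

text \<open>The constant 40 is also large enough to make the lower bound vacuous at the cut-off \<open>S div 4\<close>.\<close>

lemma level_ratio_linear:
  fixes j :: nat and lam l d q :: real
  assumes S: "S \<ge> 1" and \<Delta>: "\<Delta> \<ge> 1" "500 * \<Delta> \<le> S" and F: "100 * F \<le> S\<^sup>2" and j: "Suc j \<le> S div 4"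
  defines "lam \<equiv> real F / real S" and "l \<equiv> real F / (real S)\<^sup>2" and "d \<equiv> real \<Delta> / real S" and "q \<equiv> real j / real S"
  shows "real (Suc j) * card (level (Suc j)) \<le> card (level j) * (lam * (1 + q + l + 40 * (d + q\<^sup>2 + l\<^sup>2)))"
    "real (Suc j) * card (level (Suc j)) \<ge> card (level j) * (lam * (1 + q + l - 40 * (d + q\<^sup>2 + l\<^sup>2)) - 40 * real j * d)"
proof -
  define r where "r = real S"
  have r: "r \<ge> 1" using S unfolding r_def by linarith
  have "4 * Suc j \<le> S" using j by (simp add: less_eq_div_iff_mult_less_eq)
  then have "real (4 * Suc j) \<le> r" unfolding r_def by (rule of_nat_mono)
  then have j4: "4 * (real j + 1) \<le> r" by simp
  have "real (500 * \<Delta>) \<le> r" using \<Delta>(2) unfolding r_def by (rule of_nat_mono)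
  then have D500: "500 * real \<Delta> \<le> r" by simp
  have "real (100 * F) \<le> real (S\<^sup>2)" using F by (rule of_nat_mono)
  then have F100: "100 * real F \<le> r\<^sup>2" by (simp only: of_nat_mult of_nat_power of_nat_numeral r_def)
  have eqs: "real j = q * r" "real \<Delta> = d * r" "real F = l * r\<^sup>2" "real F = lam * r"
    unfolding q_def d_def l_def lam_def r_def[symmetric] using r by simp_all
  have q: "0 \<le> q" "q \<le> 1/4" unfolding q_def r_def[symmetric] using j4 r by (simp_all add: divide_simps)
  have d: "0 \<le> d" "d \<le> 1/500" unfolding d_def r_def[symmetric] using D500 r by (simp_all add: divide_simps)
  have l: "0 \<le> l" "l \<le> 1/100" unfolding l_def r_def[symmetric] using F100 r by (simp_all add: divide_simps)
  have lam: "0 \<le> lam" unfolding lam_def by (rule divide_nonneg_nonneg) (rule of_nat_0_le_iff)+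
  have rd: "1 \<le> d * r" using \<Delta>(1) by (simp flip: eqs(2))
  have SjS: "Suc j \<le> S" "j + 2 * \<Delta> \<le> S" using \<open>4 * Suc j \<le> S\<close> \<Delta> by simp_all
  have q34: "(1 - q)\<^sup>2 \<ge> (3/4)\<^sup>2" using q by (intro power_mono) auto
  define N N' where "N = real (card (level j))" and "N' = real (Suc j) * real (card (level (Suc j)))"
  have N: "N \<ge> 0" "N' \<ge> 0" by (auto simp: N_def N'_def)
  \<comment> \<open>\<open>P\<close> and \<open>P'\<close> bound, after division by
    \<open>r\<^sup>2\<close>, the auxiliary pairs per marked edge from below and above. In
    \<open>5 * d\<close>, three parts are blocked pairs; the other two pay for \<open>Suc j\<close>
    in place of \<open>j\<close>, since \<open>r \<le> d * r\<^sup>2\<close>.\<close>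
  define P where "P = (1 - q)\<^sup>2 - l - 5 * d"
  define P' where "P' = (1 - q)\<^sup>2 - l + d"
  have P: "P \<ge> 1/2" "P' \<ge> 1/2" using q34 l d by (simp_all add: P_def P'_def power2_eq_square)
  have r2: "r\<^sup>2 > 0" using r by simp
  have sq: "(r - (q * r + 1))\<^sup>2 = r\<^sup>2 * (1 - q)\<^sup>2 - 2 * r * (1 - q) + 1" by (simp add: power2_eq_square algebra_simps)
  have rr: "r \<le> d * r\<^sup>2" using mult_right_mono[OF rd, of r] r by (simp add: power2_eq_square mult_ac)
  have rq: "r * (1 - q) \<le> r" "r * (1 - q) \<ge> 1"
  proof -
    show "r * (1 - q) \<le> r" using q r by (simp add: mult_left_le)
    show "r * (1 - q) \<ge> 1" using j4 r by (simp add: right_diff_distrib mult.commute flip: eqs(1))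
  qed
  have "P * r\<^sup>2 \<le> (r - real (Suc j))\<^sup>2 - F - 3 * r * \<Delta>"
  proof -
    have "(r - real (Suc j))\<^sup>2 - F - 3 * r * \<Delta> = (1 - q)\<^sup>2 * r\<^sup>2 - 2 * (r * (1 - q)) + 1 - l * r\<^sup>2 - 3 * (d * r\<^sup>2)"
      using sq unfolding of_nat_Suc eqs(1,2,3) by (simp add: power2_eq_square algebra_simps)
    moreover have "P * r\<^sup>2 = (1 - q)\<^sup>2 * r\<^sup>2 - l * r\<^sup>2 - 5 * (d * r\<^sup>2)" by (simp add: P_def algebra_simps)
    ultimately show ?thesis using rr rq by linarith
  qed
  then have "N' * (P * r\<^sup>2) \<le> N' * ((r - real (Suc j))\<^sup>2 - F - 3 * r * \<Delta>)"
    using N by (intro mult_left_mono)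
  also have "\<dots> \<le> N * (F * (r - j))"
    using level_ratio_upper[OF SjS(1)] by (simp add: N_def N'_def r_def mult_ac)
  also have "F * (r - j) = lam * (1 - q) * r\<^sup>2"
    unfolding eqs(1,4) by (simp add: power2_eq_square algebra_simps)
  finally have "(N' * P) * r\<^sup>2 \<le> (N * (lam * (1 - q))) * r\<^sup>2" by (simp only: mult_ac)
  then have "N' * P \<le> N * (lam * (1 - q))" using r2 by simp
  also have "\<dots> \<le> N * (lam * (P * (1 + q + l + 40 * (d + q\<^sup>2 + l\<^sup>2))))"
    unfolding P_def by (intro mult_left_mono switching_quotient_le q l d N lam)
  finally have "N' * P \<le> (N * (lam * (1 + q + l + 40 * (d + q\<^sup>2 + l\<^sup>2)))) * P" by (simp only: mult_ac)
  then have "N' \<le> N * (lam * (1 + q + l + 40 * (d + q\<^sup>2 + l\<^sup>2)))" using P by simp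
  then show "real (Suc j) * card (level (Suc j)) \<le> card (level j) * (lam * (1 + q + l + 40 * (d + q\<^sup>2 + l\<^sup>2)))"
    by (simp add: N_def N'_def)
  have "(r - real (Suc j))\<^sup>2 - F + real (Suc j) * \<Delta> \<le> P' * r\<^sup>2"
  proof -
    have "(r - real (Suc j))\<^sup>2 - F = (1 - q)\<^sup>2 * r\<^sup>2 - 2 * (r * (1 - q)) + 1 - l * r\<^sup>2"
      using sq unfolding of_nat_Suc eqs(1,3) by (simp add: power2_eq_square algebra_simps)
    moreover have "real (Suc j) * \<Delta> \<le> d * r\<^sup>2"
    proof -
      have "real (Suc j) * \<Delta> \<le> r * \<Delta>" using j4 by (intro mult_right_mono) auto
      then show ?thesis unfolding eqs(2) by (simp add: power2_eq_square mult_ac)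
    qed
    moreover have "P' * r\<^sup>2 = (1 - q)\<^sup>2 * r\<^sup>2 - l * r\<^sup>2 + d * r\<^sup>2" by (simp add: P'_def algebra_simps)
    ultimately show ?thesis using rq by linarith
  qed
  then have "N' * ((r - real (Suc j))\<^sup>2 - F + real (Suc j) * \<Delta>) \<le> N' * (P' * r\<^sup>2)"
    using N by (intro mult_left_mono)
  moreover have "N * ((real F - real j * \<Delta>) * (r - j - 2 * \<Delta>)) \<le> N' * ((r - real (Suc j))\<^sup>2 - F + real (Suc j) * \<Delta>)"
    using level_ratio_lower[OF SjS] by (simp add: N_def N'_def r_def mult_ac)
  moreover have "(real F - real j * \<Delta>) * (r - j - 2 * \<Delta>) = ((lam - j * d) * (1 - q - 2 * d)) * r\<^sup>2"
  proof -
    have "real F - real j * \<Delta> = (lam - j * d) * r" using eqs(2,4) by (simp only: algebra_simps)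
    moreover have "r - j - 2 * \<Delta> = (1 - q - 2 * d) * r" using eqs(1,2) by (simp add: algebra_simps)
    ultimately show ?thesis by (simp add: power2_eq_square)
  qed
  ultimately have "(N * ((lam - j * d) * (1 - q - 2 * d))) * r\<^sup>2 \<le> (N' * P') * r\<^sup>2" by (simp only: mult_ac)
  then have NP': "N * ((lam - j * d) * (1 - q - 2 * d)) \<le> N' * P'" using r2 by simp
  define W where "W = 1 + q + l - 40 * (d + q\<^sup>2 + l\<^sup>2)"
  \<comment> \<open>The loss \<open>j * \<Delta>\<close> in \<open>F\<close> does not scale with
    \<open>lam\<close>, hence the separate term; as \<open>P' \<ge> 1/2\<close>,
    \<open>40 * (j * d) * P'\<close> covers it.\<close>
  have "(lam * W - 40 * (j * d)) * P' \<le> (lam - j * d) * (1 - q - 2 * d)"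
  proof -
    have "lam * (P' * W) \<le> lam * (1 - q - 2 * d)"
      unfolding P'_def W_def by (intro mult_left_mono switching_quotient_ge q l d lam)
    moreover have "j * d * (1 - q - 2 * d) \<le> j * d * 1" using q d by (intro mult_left_mono) auto
    moreover have "j * d * (1/2) \<le> j * d * P'" using P d by (intro mult_left_mono) auto
    moreover have "j * d \<ge> 0" using d by simp
    moreover have "(lam * W - 40 * (j * d)) * P' = lam * (P' * W) - 40 * (j * d * P')"
      "(lam - j * d) * (1 - q - 2 * d) = lam * (1 - q - 2 * d) - j * d * (1 - q - 2 * d)"
      by (simp_all only: algebra_simps)
    ultimately show ?thesis by linarith
  qed
  then have "N * ((lam * W - 40 * (j * d)) * P') \<le> N * ((lam - j * d) * (1 - q - 2 * d))"
    using N by (intro mult_left_mono)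
  then have "(N * (lam * W - 40 * (j * d))) * P' \<le> N' * P'" using NP' by (simp only: mult_ac)
  then have "N * (lam * W - 40 * (j * d)) \<le> N'" using P by simp
  then show "real (Suc j) * card (level (Suc j)) \<ge> card (level j) * (lam * (1 + q + l - 40 * (d + q\<^sup>2 + l\<^sup>2)) - 40 * real j * d)"
    by (simp add: N_def N'_def W_def mult.assoc)
qed

text \<open>The non-asymptotic form, whose absolute constant gives uniformity over the family. The
  sum of the levels up to \<open>S div 4\<close> is estimated by \<open>exp_family_log_sum\<close>
  and compared with the number of all graphs by \<open>tail_bound\<close>.\<close>

lemma avoiding_estimate:
  assumes "graphs \<noteq> {}" and S: "S \<ge> 15" and \<Delta>: "500 * \<Delta> \<le> S" and F: "100 * F \<le> S\<^sup>2"
  shows "card (level 0) > 0 \<and>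
    \<bar>ln (card (level 0)) - ln (card graphs) + F / S + 3 * (real F)\<^sup>2 / (2 * real S ^ 3)\<bar>
      \<le> 2000000 * (real \<Delta> * real F / (real S)\<^sup>2 + real F ^ 3 / real S ^ 5)"
proof (cases "F = 0")
  case True
  \<comment> \<open>For \<open>F = 0\<close> the first moment bound shows that no graph meets
    \<open>X\<close>, so the two counts are equal.\<close>
  have "S - 2 * \<Delta> > 0" using S \<Delta> by linarith
  then have "(\<Sum>G\<in>graphs. card (G \<inter> X)) = 0" using first_moment_bound True by simp
  then have "level 0 = graphs" by (auto simp: level_def)
  then show ?thesis using True assms(1) by (simp add: card_gt_0_iff)
next
  case False
  \<comment> \<open>A nonzero summand of \<open>F\<close> makes \<open>smax * tmax\<close> positive.
    This gives \<open>1 / r \<le> d\<close>, which lets errors of relative size \<open>1 / r\<close>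
    count as \<open>d\<close>.\<close>
  have \<Delta>1: "\<Delta> \<ge> 1"
  proof -
    obtain e where e: "e \<in> X" "s (fst e) * t (snd e) \<noteq> 0"
      using False unfolding forbidden_weight_alt by (meson sum.neutral)
    have "s (fst e) * t (snd e) \<le> smax * tmax" using e X_sub by (intro mult_mono vec_max_ge) auto
    with e(2) have "smax * tmax \<ge> 1" by linarith
    then show ?thesis unfolding delta_max_def by linarith
  qed
  define r where "r = real S"
  define K where "K = S div 4"
  define lam where "lam = real F / r"
  define l where "l = real F / r\<^sup>2"
  define d where "d = real \<Delta> / r"
  define M where "M j = (if j \<le> K then real (card (level j)) else 0)" for j
  have r: "r \<ge> 15" using S unfolding r_def by linarith
  have "real (500 * \<Delta>) \<le> r" using \<Delta> unfolding r_def by (rule of_nat_mono)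
  then have D500: "500 * real \<Delta> \<le> r" by simp
  have "real (100 * F) \<le> real (S\<^sup>2)" using F by (rule of_nat_mono)
  then have F100: "100 * real F \<le> r\<^sup>2" by (simp only: of_nat_mult of_nat_power of_nat_numeral r_def)
  have d: "0 \<le> d" "d \<le> 1/500" "1 / r \<le> d" using D500 r \<Delta>1 by (simp_all add: d_def divide_simps)
  have l: "0 \<le> l" "l \<le> 1/100" "l = lam / r" using F100 r by (simp_all add: l_def lam_def divide_simps power2_eq_square)
  have lam: "0 \<le> lam" using r by (simp add: lam_def)
  \<comment> \<open>\<open>S \<ge> 15\<close> keeps the cut-off at \<open>S / 5\<close> or more
    despite rounding.\<close>
  have "S \<le> 5 * K" using S unfolding K_def by linarith
  then have "r \<le> real (5 * K)" unfolding r_def by (rule of_nat_mono)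
  then have K5: "r \<le> 5 * real K" by simp
  have "K \<le> S" by (simp add: K_def)
  then have KS: "real K \<le> r" unfolding r_def by (rule of_nat_mono)
  have up: "real (Suc j) * M (Suc j) \<le> M j * (lam * (1 + real j / r + l + 40 * (d + (real j / r)\<^sup>2 + l\<^sup>2)))" for j
  proof (cases "Suc j \<le> K")
    case True
    then show ?thesis using level_ratio_linear(1)[of j] S \<Delta>1 \<Delta> F
      by (simp add: M_def K_def lam_def l_def d_def r_def)
  next
    case False
    then show ?thesis using lam l(1) d(1) r by (auto simp: M_def intro!: mult_nonneg_nonneg add_nonneg_nonneg)
  qed
  have low: "real (Suc j) * M (Suc j) \<ge> M j * (lam * (1 + real j / r + l - 40 * (d + (real j / r)\<^sup>2 + l\<^sup>2)) - 40 * real j * d)" for j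
  proof (cases "Suc j \<le> K")
    case True
    then show ?thesis using level_ratio_linear(2)[of j] S \<Delta>1 \<Delta> F
      by (simp add: M_def K_def lam_def l_def d_def r_def)
  next
    case False
    show ?thesis
    proof (cases "j = K")
      case True
      \<comment> \<open>As \<open>M (Suc K) = 0\<close>, the lower bound must be nonpositive here:
        \<open>q \<ge> 1/5\<close> gives \<open>40 * q\<^sup>2 \<ge> 8 * q\<close>, and
        \<open>1 + l - 7 * q < 0\<close>.\<close>
      define q where "q = real K / r"
      have q: "q \<ge> 1/5" using K5 r by (simp add: q_def divide_simps)
      then have "1/5 * q \<le> q\<^sup>2" unfolding power2_eq_square by (intro mult_right_mono) auto
      then have "1 + q + l - 40 * (d + q\<^sup>2 + l\<^sup>2) \<le> 0" using q l d zero_le_power2[of l] by (simp only: distrib_left)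
      then have "lam * (1 + q + l - 40 * (d + q\<^sup>2 + l\<^sup>2)) \<le> 0" using lam by (intro mult_nonneg_nonpos)
      moreover have "40 * real j * d \<ge> 0" using d by simp
      ultimately have "lam * (1 + real j / r + l - 40 * (d + (real j / r)\<^sup>2 + l\<^sup>2)) - 40 * real j * d \<le> 0"
        unfolding q_def True by linarith
      then show ?thesis using True by (simp add: M_def mult_nonneg_nonpos)
    qed (use False in \<open>simp add: M_def\<close>)
  qed
  have M_nonneg: "M j \<ge> 0" for j by (simp add: M_def)
  define B Z where "B = real (card graphs)" and "Z = (\<Sum>j\<le>K. M j)"
  have B: "B > 0" using assms(1) by (simp add: B_def card_gt_0_iff)
  have "Z = real (card {G \<in> graphs. card (G \<inter> X) \<le> K})"
    unfolding Z_def by (simp add: M_def flip: card_low_levels)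
  moreover have "card graphs = card {G \<in> graphs. card (G \<inter> X) \<le> K} + card {G \<in> graphs. K < card (G \<inter> X)}"
  proof -
    have "graphs = {G \<in> graphs. card (G \<inter> X) \<le> K} \<union> {G \<in> graphs. K < card (G \<inter> X)}" by auto
    then show ?thesis by (subst (1) \<open>graphs = _\<close>, subst card_Un_disjoint) auto
  qed
  moreover have "real (card {G \<in> graphs. K < card (G \<inter> X)}) \<le> 8 * l * B"
    using tail_bound S \<Delta> by (simp add: K_def l_def B_def r_def)
  ultimately have BZ: "Z \<le> B" "B - Z \<le> 8 * l * B" by (simp_all add: B_def)
  have "l * B \<le> 1/100 * B" using l B by (intro mult_right_mono) auto
  then have Z2: "B \<le> 2 * Z" using BZ B by linarith
  then have Z: "Z > 0" using B by linarith
  \<comment> \<open>If no graph avoided \<open>X\<close>, the upper ratio bounds would empty every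
    level up to \<open>K\<close> in turn, but these levels hold at least half of all graphs.\<close>
  have M0: "M 0 > 0"
  proof (rule ccontr)
    assume "\<not> M 0 > 0"
    then have "M 0 = 0" using M_nonneg[of 0] by linarith
    then have "M j = 0" for j
    proof (induction j)
      case (Suc j)
      then have "real (Suc j) * M (Suc j) \<le> 0" using up[of j] by simp
      then have "M (Suc j) \<le> 0" by (simp add: mult_le_0_iff)
      then show ?case using M_nonneg[of "Suc j"] by linarith
    qed
    then show False using Z by (simp add: Z_def)
  qed
  define \<epsilon> where "\<epsilon> = lam * d + lam * l\<^sup>2"
  have est: "\<bar>ln Z - ln (M 0) - lam - 3 / 2 * lam * l\<bar>
      \<le> (2 * (40 * ((3 + 3 * 40)\<^sup>2 + 2 * (3 + 3 * 40) + 2)) + 1 + (3 + 3 * 40)) * \<epsilon>"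
    unfolding Z_def \<epsilon>_def
  proof (rule exp_family_log_sum[where S = r])
    show "M j = 0" if "K < j" for j using that by (simp add: M_def)
  qed (use M_nonneg M0 KS r lam l d up low in auto)
  \<comment> \<open>Truncation changes the logarithm by at most \<open>16 * l\<close>, and
    \<open>l = lam / r \<le> lam * d\<close> puts this inside the error term.\<close>
  have "\<bar>ln B - ln Z\<bar> \<le> 16 * \<epsilon>"
  proof -
    have "ln (B / Z) \<le> B / Z - 1" using B Z by (intro ln_le_minus_one) simp
    also have "\<dots> = (B - Z) / Z" using Z by (simp add: field_simps)
    also have "\<dots> \<le> 16 * l * Z / Z"
    proof (intro divide_right_mono)
      have "l * B \<le> l * (2 * Z)" using l Z2 by (intro mult_left_mono) auto
      then show "B - Z \<le> 16 * l * Z" using BZ by linarith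
    qed (use Z in simp)
    also have "\<dots> = 16 * l" using Z by simp
    also have "l \<le> \<epsilon>"
    proof -
      have "l \<le> lam * d" using mult_left_mono[OF d(3) lam] by (simp add: l(3))
      then show ?thesis unfolding \<epsilon>_def using lam by (smt (verit) mult_nonneg_nonneg zero_le_power2)
    qed
    finally show ?thesis using B Z BZ by (simp add: ln_div)
  qed
  then have "\<bar>ln (M 0) - ln B + lam + 3 / 2 * lam * l\<bar> \<le> (16 + (2 * (40 * ((3 + 3 * 40)\<^sup>2 + 2 * (3 + 3 * 40) + 2)) + 1 + (3 + 3 * 40))) * \<epsilon>"
    using est by (simp add: distrib_right)
  \<comment> \<open>The coefficient on the left evaluates to 1230300.\<close>
  also have "\<dots> \<le> 2000000 * \<epsilon>"
    using lam d by (intro mult_right_mono) (auto simp: \<epsilon>_def)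
  finally have "\<bar>ln (M 0) - ln B + lam + 3 / 2 * lam * l\<bar> \<le> 2000000 * \<epsilon>" .
  moreover have "M 0 = card (level 0)" by (simp add: M_def)
  moreover have "3 / 2 * lam * l = 3 * (real F)\<^sup>2 / (2 * r ^ 3)"
    by (simp add: lam_def l_def power2_eq_square power3_eq_cube)
  moreover have "\<epsilon> = real \<Delta> * real F / r\<^sup>2 + real F ^ 3 / r ^ 5"
    by (simp add: \<epsilon>_def lam_def l_def d_def power2_eq_square power3_eq_cube eval_nat_numeral mult_ac)
  ultimately show ?thesis using M0 by (simp add: B_def lam_def r_def)
qed

end

section \<open>Passage from the explicit estimate to the limit\<close>

theorem theorem2p2:
  fixes L :: "'i filter"
    and m n :: "'i \<Rightarrow> nat"
    and s t :: "'i \<Rightarrow> nat \<Rightarrow> nat"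
    and X :: "'i \<Rightarrow> bigraph"
    and S F \<delta> :: "'i \<Rightarrow> real"
  assumes S_s: "\<And>k. S k = real (\<Sum>i=1..m k. s k i)"
    and S_t: "\<And>k. S k = real (\<Sum>j=1..n k. t k j)"
    and X: "\<And>k. X k \<subseteq> {1..m k} \<times> {1..n k}"
    and F: "\<And>k. F k = real (forbidden_weight (s k) (t k) (X k))"
    and \<delta>: "\<And>k. \<delta> k = real (delta_max (m k) (n k) (s k) (t k) (X k))"
    and S_limit: "filterlim S at_top L"
    and max_small: "(\<lambda>k. real (vec_max (m k) (s k) + vec_max (n k) (t k))) \<in> o[L](\<lambda>k. S k / ln (S k))"
    and \<delta>_small: "\<delta> \<in> o[L](S)"
    and \<delta>F_small: "(\<lambda>k. \<delta> k * F k) \<in> o[L](\<lambda>k. S k ^ 2)"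
    and F_small: "F \<in> o[L](\<lambda>k. S k powr (5 / 3))"
  shows "\<exists>E :: 'i \<Rightarrow> real.
     E \<in> O[L](\<lambda>k. \<delta> k * F k / S k ^ 2 + F k ^ 3 / S k ^ 5) \<and>
     (\<forall>\<^sub>F k in L.
        real (num_bigraphs_avoiding (m k) (n k) (s k) (t k) (X k)) =
        real (num_bigraphs (m k) (n k) (s k) (t k)) *
          exp (- (F k / S k) - 3 * F k ^ 2 / (2 * S k ^ 3) + E k))"
proof -
  define B where "B k = real (num_bigraphs (m k) (n k) (s k) (t k))" for k
  define A where "A k = real (num_bigraphs_avoiding (m k) (n k) (s k) (t k) (X k))" for k
  \<comment> \<open>\<open>E\<close> is what the identity forces when graphs exist. When
    \<open>B k = 0\<close> both counts vanish, the identity holds for any exponent, and the value 0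
    respects the error bound.\<close>
  define E where "E k = (if B k = 0 then 0 else ln (A k) - ln (B k) + F k / S k + 3 * F k ^ 2 / (2 * S k ^ 3))" for k
  \<comment> \<open>The thresholds 15, 1/500 and 1/100 are those of
    \<open>avoiding_estimate\<close>.\<close>
  have S_large: "\<forall>\<^sub>F k in L. S k \<ge> 15" using S_limit by (simp add: filterlim_at_top)
  have "\<forall>\<^sub>F k in L. norm (\<delta> k) \<le> (1/500) * norm (S k)" using landau_o.smallD[OF \<delta>_small, of "1/500"] by simp
  moreover have "\<forall>\<^sub>F k in L. norm (F k) \<le> (1/100) * norm (S k powr (5 / 3))"
    using landau_o.smallD[OF F_small, of "1/100"] by simp
  ultimately have main: "\<forall>\<^sub>F k in L. \<bar>E k\<bar> \<le> 2000000 * (\<delta> k * F k / S k ^ 2 + F k ^ 3 / S k ^ 5)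
      \<and> A k = B k * exp (- (F k / S k) - 3 * F k ^ 2 / (2 * S k ^ 3) + E k)"
    using S_large
  proof eventually_elim
    case (elim k)
    interpret forbidden_edges "m k" "n k" "s k" "t k" "X k" by unfold_locales (rule X)
    have A: "A k = card (level 0)" by (simp add: A_def num_bigraphs_avoiding_eq_level_0)
    have B: "B k = card (bigraphs (m k) (n k) (s k) (t k))" by (simp add: B_def num_bigraphs_def)
    have nn: "\<delta> k \<ge> 0" "F k \<ge> 0" by (simp_all add: \<delta> F)
    show ?case
    proof (cases "bigraphs (m k) (n k) (s k) (t k) = {}")
      case True
      then have "A k = 0" "B k = 0" unfolding A B by (auto simp: level_def)
      then show ?thesis using nn elim(3) by (simp add: E_def)
    next
      case False
      then have "B k > 0" unfolding B by (simp add: card_gt_0_iff)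
      \<comment> \<open>Since \<open>S k \<ge> 1\<close>, the smallness of \<open>F\<close> relative
        to \<open>S powr (5 / 3)\<close> yields the hypothesis
        \<open>100 * F \<le> S\<^sup>2\<close>.\<close>
      have "S k powr (5 / 3) \<le> S k powr 2" using elim(3) by (intro powr_mono) auto
      then have "100 * F k \<le> (S k)\<^sup>2" using elim nn by simp
      then have "real (100 * forbidden_weight (s k) (t k) (X k)) \<le> real ((\<Sum>i=1..m k. s k i)\<^sup>2)"
        unfolding S_s F by simp
      moreover have "real (500 * delta_max (m k) (n k) (s k) (t k) (X k)) \<le> real (\<Sum>i=1..m k. s k i)"
        using elim(1,3) nn unfolding S_s \<delta> by simp
      moreover have "real 15 \<le> real (\<Sum>i=1..m k. s k i)" using elim(3) unfolding S_s by simp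
      ultimately have *: "card (level 0) > 0 \<and> \<bar>ln (A k) - ln (B k) + F k / S k + 3 * (F k)\<^sup>2 / (2 * S k ^ 3)\<bar>
          \<le> 2000000 * (\<delta> k * F k / (S k)\<^sup>2 + F k ^ 3 / S k ^ 5)"
        using avoiding_estimate[OF False] unfolding of_nat_le_iff A B F S_s \<delta> by blast
      then have "A k > 0" by (simp add: A)
      moreover have "- (F k / S k) - 3 * F k ^ 2 / (2 * S k ^ 3) + E k = ln (A k / B k)"
        using \<open>B k > 0\<close> \<open>A k > 0\<close> by (simp add: E_def ln_div)
      ultimately show ?thesis using * \<open>B k > 0\<close> by (simp add: E_def)
    qed
  qed
  have "E \<in> O[L](\<lambda>k. \<delta> k * F k / S k ^ 2 + F k ^ 3 / S k ^ 5)"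
  proof (rule landau_o.bigI[of 2000000])
    show "\<forall>\<^sub>F k in L. norm (E k) \<le> 2000000 * norm (\<delta> k * F k / S k ^ 2 + F k ^ 3 / S k ^ 5)"
      using main by eventually_elim (auto simp: abs_if)
  qed simp
  moreover have "\<forall>\<^sub>F k in L. A k = B k * exp (- (F k / S k) - 3 * F k ^ 2 / (2 * S k ^ 3) + E k)"
    using main by eventually_elim auto
  ultimately show ?thesis unfolding A_def B_def by blast
qed

end
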